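(* Suppose $(A,B)$ is controllable, $(Q^{1/2},A)$ is observable, $B_w$ has full row rank, and $Q\succ0$, $R\succ0$. Then the state feedback $\mathcal{H}_\infty$ policy optimization problem of minimizing $J_\infty(K)=\|\mathbf{T}_{zw}(K,s)\|_{\mathcal{H}_\infty}$ over $K\in\mathcal{K}$ is equivalent to a convex problem in the sense that $$\inf_{K\in\mathcal{K}}J_\infty(K)=\inf_{(\gamma,Y,X)\in\mathcal{F}_\infty}\gamma.$$ Furthermore, any Clarke stationary point of this problem (i.e. any $K\in\mathcal{K}$ with $0\in\partial J_\infty(K)$) is globally optimal.
   Context: Setting: $A\in\mathbb{R}^{n\times n}$, $B\in\mathbb{R}^{n\times m}$, $B_w\in\mathbb{R}^{n\times n}$, $Q\in\mathbb{S}^n$, $R\in\mathbb{S}^m$. $\mathcal{K}=\{K\in\mathbb{R}^{m\times n}\mid\max_i\operatorname{Re}\lambda_i(A+BK)<0\}$ (an open set). $\mathbf{T}_{zw}(K,s)=\begin{bmatrix}Q^{1/2}\\ R^{1/2}K\end{bmatrix}(sI-A-BK)^{-1}B_w$, and $\|\mathbf{T}\|_{\mathcal{H}_\infty}=\sup_{\omega\in\mathbb{R}}\sigma_{\max}(\mathbf{T}(j\omega))$. $\partial J_\infty$ is the Clarke subdifferential of the locally Lipschitz function $J_\infty$ on $\mathcal{K}$: $\partial f(x)=\{g:\langle g,v\rangle\le\limsup_{x'\to x,t\downarrow0}\frac{f(x'+tv)-f(x')}{t}\ \forall v\}$. The convex set is $$\mathcal{F}_\infty=\left\{(\gamma,Y,X)\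 \middle|\ X\succ0,\ Y\in\mathbb{R}^{m\times n},\ \begin{bmatrix}AX+BY+XA^{\mathsf T}+Y^{\mathsf T}B^{\mathsf T}&B_w&XQ^{1/2}&Y^{\mathsf T}R^{1/2}\\ B_w^{\mathsf T}&-\gamma I&0&0\\ Q^{1/2}X&0&-\gamma I&0\\ R^{1/2}Y&0&0&-\gamma I\end{bmatrix}\preceq0\right\},$$ with $\gamma\in\mathbb{R}$, $X\in\mathbb{S}^n$. *)

theory Defs
  imports "HOL-Analysis.Analysis"
begin

definition posdef :: "real^'n^'n \<Rightarrow> bool" where
  "posdef M \<longleftrightarrow> transpose M = M \<and> (\<forall>x. x \<noteq> 0 \<longrightarrow> 0 < x \<bullet> (M *v x))"

definition possemidef :: "real^'n^'n \<Rightarrow> bool" where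
  "possemidef M \<longleftrightarrow> transpose M = M \<and> (\<forall>x. 0 \<le> x \<bullet> (M *v x))"

definition negsemidef :: "real^'n^'n \<Rightarrow> bool" where
  "negsemidef M \<longleftrightarrow> possemidef (- M)"

(* The principal square root; it exists and is unique when Q is positive semidefinite. *)
definition msqrt :: "real^'n^'n \<Rightarrow> real^'n^'n" where
  "msqrt Q = (THE S. possemidef S \<and> S ** S = Q)"

definition hcat :: "'a^'p^'k \<Rightarrow> 'a^'q^'k \<Rightarrow> 'a^('p + 'q)^'k"  (infixr "|||" 60) where
  "M ||| N = (\<chi> i j. case j of Inl p \<Rightarrow> M $ i $ p | Inr q \<Rightarrow> N $ i $ q)"

definition vcat :: "'a^'k^'p \<Rightarrow> 'a^'k^'q \<Rightarrow> 'a^'k^('p + 'q)"  (infixr "'/'/'/" 55) where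
  "M /// N = (\<chi> i. case i of Inl p \<Rightarrow> M $ p | Inr q \<Rightarrow> N $ q)"

(* The rank of the matrix [B, A B, ..., A^(n-1) B] is n. The dimension of the span of all
   columns of the blocks is used, so that no indexing of the columns of that matrix is needed. *)
definition controllable :: "real^'n^'n \<Rightarrow> real^'m^'n \<Rightarrow> bool" where
  "controllable A B \<longleftrightarrow>
     dim (\<Union>k<CARD('n). columns ((((**) A) ^^ k) B)) = CARD('n)"

(* Likewise for the stacked matrix with the blocks C, C A, ..., C A^(n-1). *)
definition observable :: "real^'n^'p \<Rightarrow> real^'n^'n \<Rightarrow> bool" where
  "observable C A \<longleftrightarrow>
     dim (\<Union>k<CARD('n). rows (((\<lambda>M. M ** A) ^^ k) C)) = CARD('n)"

abbreviation cmat :: "real^'n^'m \<Rightarrow> complex^'n^'m" where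
  "cmat \<equiv> map_matrix complex_of_real"

definition conj_transpose :: "complex^'n^'m \<Rightarrow> complex^'m^'n" where
  "conj_transpose M = map_matrix cnj (transpose M)"

definition eigenvalues :: "complex^'n^'n \<Rightarrow> complex set" where
  "eigenvalues M = {\<mu>. \<exists>v. v \<noteq> 0 \<and> M *v v = \<mu> *s v}"

definition singular_values :: "complex^'n^'m \<Rightarrow> real set" where
  "singular_values M =
     {\<sigma>. 0 \<le> \<sigma> \<and> complex_of_real (\<sigma>\<^sup>2) \<in> eigenvalues (conj_transpose M ** M)}"

definition sigma_max :: "complex^'n^'m \<Rightarrow> real" where
  "sigma_max M = Max (singular_values M)"

definition stabilizing :: "real^'n^'n \<Rightarrow> real^'m^'n \<Rightarrow> (real^'n^'m) set" where
  "stabilizing A B = {K. Max (Re ` eigenvalues (cmat (A + B ** K))) < 0}"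

definition T_zw :: "real^'n^'n \<Rightarrow> real^'m^'n \<Rightarrow> real^'n^'n \<Rightarrow> real^'n^'n \<Rightarrow> real^'m^'m \<Rightarrow>
    real^'n^'m \<Rightarrow> complex \<Rightarrow> complex^'n^('n + 'm)" where
  "T_zw A B B\<^sub>w Q R K s =
     cmat (msqrt Q /// msqrt R ** K) ** matrix_inv (mat s - cmat A - cmat (B ** K)) ** cmat B\<^sub>w"

(* A real supremum, meaningful only for transfer functions that are bounded on the imaginary
   axis; this is the case for T_zw at every stabilizing gain. *)
definition hinf_norm :: "(complex \<Rightarrow> complex^'n^'m) \<Rightarrow> real" where
  "hinf_norm T = (SUP \<omega>::real. sigma_max (T (\<i> * complex_of_real \<omega>)))"

definition J_inf :: "real^'n^'n \<Rightarrow> real^'m^'n \<Rightarrow> real^'n^'n \<Rightarrow> real^'n^'n \<Rightarrow> real^'m^'m \<Rightarrow>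
    real^'n^'m \<Rightarrow> real" where
  "J_inf A B B\<^sub>w Q R K = hinf_norm (T_zw A B B\<^sub>w Q R K)"

(* The inner product on real matrices is the Frobenius one. Only the values of f near x matter,
   so f may be arbitrary outside an open set containing x. *)
definition clarke_subdiff :: "('a::real_inner \<Rightarrow> real) \<Rightarrow> 'a \<Rightarrow> 'a set" where
  "clarke_subdiff f x = {g. \<forall>v. ereal (g \<bullet> v) \<le>
     Limsup (nhds x \<times>\<^sub>F at_right (0::real)) (\<lambda>(x', t). ereal ((f (x' + t *\<^sub>R v) - f x') / t))}"

definition F_inf :: "real^'n^'n \<Rightarrow> real^'m^'n \<Rightarrow> real^'n^'n \<Rightarrow> real^'n^'n \<Rightarrow> real^'m^'m \<Rightarrow>
    (real \<times> (real^'n^'m) \<times> (real^'n^'n)) set" where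
  "F_inf A B B\<^sub>w Q R = {(\<gamma>, Y, X). posdef X \<and>
     negsemidef
       (   A ** X + B ** Y + X ** transpose A + transpose Y ** transpose B
                           ||| B\<^sub>w         ||| X ** msqrt Q ||| transpose Y ** msqrt R
       /// transpose B\<^sub>w    ||| mat (- \<gamma>)  ||| 0            ||| 0
       /// msqrt Q ** X    ||| 0          ||| mat (- \<gamma>)    ||| 0
       /// msqrt R ** Y    ||| 0          ||| 0            ||| mat (- \<gamma>))}"

end

theory Submission
  imports Defs "HOL-Computational_Algebra.Fundamental_Theorem_Algebra"
begin

text \<open>Write \<open>A\<^sub>K = A + B K\<close>. For a positive definite \<open>X\<close>, the block inequality says that the quadratic form
  \<open>2 v \<bullet> A\<^sub>K X v + 2 v \<bullet> B\<^sub>w w + (|Q\<^sup>1\<^sup>/\<^sup>2 X v|\<^sup>2 + |R\<^sup>1\<^sup>/\<^sup>2 K X v|\<^sup>2) / \<gamma> - \<gamma> |w|\<^sup>2\<close> is nonpositive, where \<open>Y = K X\<close> (\<open>F_iff\<close>,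
  \<open>F_gain_bounds\<close>). Evaluating it at \<open>v = X\<^sup>-\<^sup>1 x\<close> along eigenvectors of \<open>A\<^sub>K\<close>, and along the harmonic responses
  \<open>i \<omega> x = A\<^sub>K x + B\<^sub>w w\<close>, shows that \<open>K\<close> is stabilizing with cost at most \<open>\<gamma>\<close> (\<open>F_imp_cost_le\<close>).

  Conversely, every stabilizing \<open>K\<close> has an \<open>X\<close> that is feasible with \<open>\<gamma> = J K\<close> itself, not merely with every larger
  \<open>\<gamma>\<close> (\<open>stabilizing_imp_F\<close>). This is the nonstrict Kalman-Yakubovich-Popov lemma \<open>kyp\<close>, which needs no strict inequality
  because \<open>B\<^sub>w\<close> is square and invertible, so that the state \<open>x\<close> and its velocity \<open>y\<close> may be prescribed
  independently. It follows by separating a point from a convex cone; that the point is outside the cone reduces, after a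
  normalization of second moments, to summing the frequency-domain inequality over an eigenbasis of a skew-symmetric
  matrix. The solution \<open>Z = J K X\<^sup>-\<^sup>1\<close> that it yields is positive definite because \<open>A\<^sub>K\<close> is stable
  (\<open>lyapunov_posdef\<close>). Both directions together give the equality of the infima.

  For the stationary points, let \<open>J K' < J K\<close>, and take feasible points over \<open>K\<close> and \<open>K'\<close> with \<open>\<gamma> = J K\<close> and
  \<open>\<gamma> = J K'\<close>. The segment between them lies in the convex set and projects to a curve of gains that starts at \<open>K\<close> with some
  velocity \<open>v\<close> and along which \<open>J\<close> decreases at least linearly. Near \<open>K\<close> the transfer function is an affine function of
  the gain up to quadratic errors, uniformly in the frequency; as \<open>J\<close> is a supremum of norms, it is locally
  Lipschitz and weakly convex there (\<open>local_estimates\<close>). Hence its Clarke derivative at \<open>K\<close> in direction \<open>v\<close> is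
  bounded by difference quotients at \<open>K\<close> itself, and is negative
  (\<open>clarke_stationary_weakly_convex\<close>, \<open>stationary_imp_optimal\<close>).\<close>



section \<open>Self-adjoint maps and second moments\<close>

lemma self_adjoint_maximizer:
  fixes f :: "'a::euclidean_space \<Rightarrow> 'a"
  assumes lin: "linear f" and sa: "\<And>x y. f x \<bullet> y = x \<bullet> f y"
    and V: "subspace V" and inv: "f ` V \<subseteq> V" and ne: "V \<noteq> {0}"
  obtains b where "b \<in> V" "norm b = 1" "f b = (b \<bullet> f b) *\<^sub>R b"
    "\<And>x. x \<in> V \<Longrightarrow> x \<bullet> f x \<le> (b \<bullet> f b) * (x \<bullet> x)"
proof -
  define S where "S = {x \<in> V. norm x = 1}"
  have "S = V \<inter> sphere 0 1" by (auto simp: S_def)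
  moreover have "closed V" using V by (rule closed_subspace)
  ultimately have comp: "compact S"
    using closed_Int_compact[OF \<open>closed V\<close> compact_sphere[of 0 1]] by simp
  obtain x0 where x0: "x0 \<in> V" "x0 \<noteq> 0" using ne subspace_0[OF V] by auto
  then have "x0 /\<^sub>R norm x0 \<in> S" using V by (auto simp: S_def subspace_scale)
  then have Sne: "S \<noteq> {}" by auto
  have "continuous_on S (\<lambda>x. x \<bullet> f x)"
    by (intro continuous_intros linear_continuous_on linear_conv_bounded_linear[THEN iffD1] lin)
  from continuous_attains_sup[OF comp Sne this]
  obtain b where b: "b \<in> S" "\<And>x. x \<in> S \<Longrightarrow> x \<bullet> f x \<le> b \<bullet> f b" by auto
  define l where "l = b \<bullet> f b"
  interpret f: linear f by fact
  have le: "x \<bullet> f x \<le> l * (x \<bullet> x)" if x: "x \<in> V" for x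
  proof (cases "x = 0")
    case True then show ?thesis by (simp add: f.zero)
  next
    case False
    then have "x /\<^sub>R norm x \<in> S" using V x by (auto simp: S_def subspace_scale)
    from b(2)[OF this] False show ?thesis
      by (simp add: f.scaleR l_def field_simps dot_square_norm power2_eq_square)
  qed
  have bV: "b \<in> V" and nb: "norm b = 1" using b(1) by (auto simp: S_def)
  define g where "g = f b - l *\<^sub>R b"
  have gV: "g \<in> V" unfolding g_def using V bV inv by (auto intro!: subspace_diff subspace_scale)
  have "g = 0"
  proof (rule ccontr)
    assume "g \<noteq> 0"
    then have gg: "0 < g \<bullet> g" by simp
    define k where "k = l * (g \<bullet> g) - g \<bullet> f g"
    have k: "0 \<le> k" using le[OF gV] by (simp add: k_def)
    \<comment> \<open>The form \<open>l |x|\<^sup>2 - x \<bullet> f x\<close> is nonnegative on the line through \<open>b\<close> in direction \<open>g\<close> and vanishes at \<open>b\<close>,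
      so its derivative there, \<open>-2 |g|\<^sup>2\<close>, is zero.\<close>
    have key: "2 * t * (g \<bullet> g) \<le> t\<^sup>2 * k" for t
    proof -
      have "b + t *\<^sub>R g \<in> V" using V bV gV by (auto intro!: subspace_add subspace_scale)
      from le[OF this] have "b \<bullet> f b + t * (b \<bullet> f g) + t * (g \<bullet> f b) + t * t * (g \<bullet> f g)
          \<le> l * (b \<bullet> b) + 2 * t * l * (b \<bullet> g) + t * t * l * (g \<bullet> g)"
        by (simp add: f.add f.scaleR inner_add_left inner_add_right inner_commute[of g b] algebra_simps)
      moreover have "b \<bullet> f g = f b \<bullet> g" by (simp add: sa)
      moreover have "b \<bullet> b = 1" using nb by (simp add: dot_square_norm)
      moreover have "f b \<bullet> g = g \<bullet> g + l * (b \<bullet> g)" by (simp add: g_def inner_diff_left inner_diff_right algebra_simps)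
      ultimately have "t * (g \<bullet> g + l * (b \<bullet> g)) + t * (g \<bullet> g + l * (b \<bullet> g)) + t * t * (g \<bullet> f g)
          \<le> 2 * t * l * (b \<bullet> g) + t * t * l * (g \<bullet> g)"
        by (simp add: inner_commute[of g "f b"] flip: l_def)
      then show ?thesis by (simp add: k_def power2_eq_square algebra_simps)
    qed
    define t where "t = (g \<bullet> g) / (k + 1)"
    have t: "0 < t" "t * (k + 1) = g \<bullet> g" using gg k by (simp_all add: t_def)
    have "t * (2 * (g \<bullet> g)) \<le> t * (t * k)" using key[of t] by (simp add: power2_eq_square mult_ac)
    then have "2 * (g \<bullet> g) \<le> t * k" using t(1) by simp
    then show False using t gg by (simp add: algebra_simps)
  qed
  then have "f b = (b \<bullet> f b) *\<^sub>R b" by (simp add: g_def l_def)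
  with that bV nb le show thesis by (simp add: l_def)
qed

text \<open>The spectral theorem, for the restriction of a self-adjoint map to an invariant subspace.\<close>

lemma self_adjoint_eigenbasis:
  fixes f :: "'a::euclidean_space \<Rightarrow> 'a"
  assumes lin: "linear f" and sa: "\<And>x y. f x \<bullet> y = x \<bullet> f y"
  shows "subspace V \<Longrightarrow> f ` V \<subseteq> V \<Longrightarrow>
    \<exists>B. finite B \<and> pairwise orthogonal B \<and> (\<forall>b\<in>B. norm b = 1 \<and> f b = (b \<bullet> f b) *\<^sub>R b) \<and> span B = V"
proof (induction "dim V" arbitrary: V rule: less_induct)
  case less
  show ?case
  proof (cases "V = {0}")
    case True
    then show ?thesis by (intro exI[of _ "{}"]) auto
  next
    case False
    from self_adjoint_maximizer[OF lin sa less.prems False]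
    obtain b where b: "b \<in> V" "norm b = 1" "f b = (b \<bullet> f b) *\<^sub>R b" by metis
    define W where "W = {x \<in> V. b \<bullet> x = 0}"
    have W: "subspace W"
      using less.prems(1) by (auto simp: W_def subspace_def inner_add_right)
    have fW: "f ` W \<subseteq> W"
    proof -
      have "b \<bullet> f x = 0" if "b \<bullet> x = 0" for x
        using that b(3) sa[of b x] by (metis inner_scaleR_left mult_zero_right)
      then show ?thesis using less.prems(2) by (auto simp: W_def)
    qed
    have "b \<notin> W" using b(2) by (auto simp: W_def)
    moreover have "W \<subseteq> V" by (auto simp: W_def)
    ultimately have "W \<subset> V" using b(1) by blast
    then have "dim W < dim V"
      using W less.prems(1) dim_psubset[of W V] by (simp add: span_eq_iff[THEN iffD2])
    from less.hyps[OF this W fW] obtain B where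
      B: "finite B" "pairwise orthogonal B" "\<forall>b\<in>B. norm b = 1 \<and> f b = (b \<bullet> f b) *\<^sub>R b" "span B = W" by auto
    have BW: "B \<subseteq> W" using B(4) span_superset by auto
    have "span (insert b B) = V"
    proof (intro equalityI subsetI)
      fix x assume "x \<in> span (insert b B)"
      then show "x \<in> V" using b(1) BW less.prems(1)
        by (metis (no_types, lifting) W_def insert_subset mem_Collect_eq span_minimal subsetD subsetI)
    next
      fix x assume x: "x \<in> V"
      have "x - (b \<bullet> x) *\<^sub>R b \<in> W"
        using x b less.prems(1) dot_square_norm[of b]
        by (auto simp: W_def inner_diff_right intro!: subspace_diff subspace_scale)
      then show "x \<in> span (insert b B)" using B(4) by (auto simp: span_insert)
    qed
    moreover have "pairwise orthogonal (insert b B)"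
      using B(2) BW by (auto simp: pairwise_insert orthogonal_def W_def inner_commute)
    ultimately show ?thesis using B b by (intro exI[of _ "insert b B"]) auto
  qed
qed

lemma orthonormal_parseval:
  fixes B :: "'a::euclidean_space set"
  assumes B: "finite B" "pairwise orthogonal B" "\<And>b. b \<in> B \<Longrightarrow> norm b = 1" "span B = UNIV"
  shows "(\<Sum>b\<in>B. (b \<bullet> x) * (b \<bullet> y)) = x \<bullet> y"
proof -
  have "x = (\<Sum>b\<in>B. (b \<bullet> x) *\<^sub>R b)"
    using orthonormal_basis_expand[of B x] B by (simp add: inner_commute)
  then have "x \<bullet> y = (\<Sum>b\<in>B. (b \<bullet> x) *\<^sub>R b) \<bullet> y" by simp
  then show ?thesis by (simp add: inner_sum_left)
qed

text \<open>The sum of \<open>\<beta> x x\<close> over a finite family depends only on \<open>\<Sum> x x\<^sup>T\<close>. In particular, all orthonormal bases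
  give the same sum, the trace of \<open>\<beta>\<close>.\<close>

lemma sum_bilinear_second_moments:
  fixes \<beta> :: "'a::euclidean_space \<Rightarrow> 'a \<Rightarrow> real"
  assumes "bilinear \<beta>"
    and "\<And>u v. (\<Sum>i\<in>I. (u \<bullet> x i) * (v \<bullet> x i)) = (\<Sum>j\<in>J. (u \<bullet> y j) * (v \<bullet> y j))"
  shows "(\<Sum>i\<in>I. \<beta> (x i) (x i)) = (\<Sum>j\<in>J. \<beta> (y j) (y j))"
proof -
  have ex: "\<beta> a b = (\<Sum>e\<in>Basis. \<Sum>e'\<in>Basis. ((e \<bullet> a) * (e' \<bullet> b)) * \<beta> e e')" for a b
  proof -
    have "\<beta> a b = \<beta> (\<Sum>e\<in>Basis. (e \<bullet> a) *\<^sub>R e) (\<Sum>e'\<in>Basis. (e' \<bullet> b) *\<^sub>R e')"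
      by (simp add: euclidean_representation inner_commute[of _ a] inner_commute[of _ b])
    also have "\<dots> = (\<Sum>e\<in>Basis. \<Sum>e'\<in>Basis. ((e \<bullet> a) * (e' \<bullet> b)) * \<beta> e e')"
      using bilinear_sum[OF assms(1), of "\<lambda>e. (e \<bullet> a) *\<^sub>R e" Basis "\<lambda>e'. (e' \<bullet> b) *\<^sub>R e'" Basis]
      by (simp add: bilinear_lmul[OF assms(1)] bilinear_rmul[OF assms(1)] sum.cartesian_product mult_ac)
    finally show ?thesis .
  qed
  have sw: "(\<Sum>i\<in>I. \<beta> (x i) (x i)) = (\<Sum>e\<in>Basis. \<Sum>e'\<in>Basis. (\<Sum>i\<in>I. (e \<bullet> x i) * (e' \<bullet> x i)) * \<beta> e e')"
    for I and x :: "'i \<Rightarrow> 'a"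
    by (subst ex, subst sum.swap, rule sum.cong[OF refl], subst sum.swap) (simp add: sum_distrib_right)
  show ?thesis
    by (simp only: sw assms(2))
qed


section \<open>Square roots of positive semidefinite matrices\<close>

lemma inner_symmetric_matrix:
  fixes M :: "real^'n^'n"
  assumes "transpose M = M"
  shows "(M *v x) \<bullet> y = x \<bullet> (M *v y)"
proof -
  have "(M *v x) \<bullet> y = (transpose M *v x) \<bullet> y" by (simp only: assms)
  then show ?thesis by (simp add: dot_lmul_matrix)
qed

lemma symmetric_matrixI:
  fixes M :: "real^'n^'n"
  assumes "\<And>x y. (M *v x) \<bullet> y = x \<bullet> (M *v y)"
  shows "transpose M = M"
proof -
  have "(transpose M *v x) \<bullet> y = (M *v x) \<bullet> y" for x y
    by (simp add: assms dot_lmul_matrix)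
  then have "transpose M *v x = M *v x" for x
    using vector_eq_rdot by blast
  then show ?thesis by (subst matrix_eq) blast
qed

lemma possemidef_sqrt_exists:
  fixes Q :: "real^'n^'n"
  assumes "possemidef Q"
  shows "\<exists>S. possemidef S \<and> S ** S = Q"
proof -
  have sa: "(Q *v x) \<bullet> y = x \<bullet> (Q *v y)" for x y
    using assms by (intro inner_symmetric_matrix) (simp add: possemidef_def)
  from self_adjoint_eigenbasis[of "(*v) Q" UNIV] sa obtain B where
    B: "finite B" "pairwise orthogonal B" "\<forall>b\<in>B. norm b = 1 \<and> Q *v b = (b \<bullet> (Q *v b)) *\<^sub>R b" "span B = UNIV"
    by auto
  define l where "l b = b \<bullet> (Q *v b)" for b
  have l0: "0 \<le> l b" for b using assms by (simp add: l_def possemidef_def)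
  have Qb: "Q *v b = l b *\<^sub>R b" if "b \<in> B" for b using B(3) that by (simp add: l_def)
  have pars: "(\<Sum>b\<in>B. (b \<bullet> x) * (b \<bullet> y)) = x \<bullet> y" for x y
    by (rule orthonormal_parseval) (use B in auto)
  define f where "f x = (\<Sum>b\<in>B. (sqrt (l b) * (b \<bullet> x)) *\<^sub>R b)" for x
  have lin: "linear f"
    by (rule linearI) (simp_all add: f_def inner_add_right algebra_simps scaleR_add_left sum.distrib scaleR_sum_right)
  define S where "S = matrix f"
  have S: "S *v x = f x" for x by (simp add: S_def matrix_works lin)
  have fb: "f b = sqrt (l b) *\<^sub>R b" if "b \<in> B" for b
  proof -
    have bb: "b' \<bullet> b = (if b' = b then 1 else 0)" if "b' \<in> B" for b'
      using B(2,3) that \<open>b \<in> B\<close> by (auto simp: pairwise_def orthogonal_def dot_square_norm)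
    have "f b = (\<Sum>b'\<in>B. if b' = b then sqrt (l b) *\<^sub>R b else 0)"
      unfolding f_def by (rule sum.cong[OF refl]) (simp add: bb)
    then show ?thesis using B(1) that by simp
  qed
  have fsa: "f x \<bullet> y = x \<bullet> f y" for x y
    by (simp add: f_def inner_sum_left inner_sum_right inner_commute[of x] mult_ac)
  have "possemidef S"
    unfolding possemidef_def
  proof (intro conjI allI)
    show "transpose S = S" by (rule symmetric_matrixI) (simp add: S fsa)
    have "x \<bullet> (S *v x) = (\<Sum>b\<in>B. sqrt (l b) * (b \<bullet> x)\<^sup>2)" for x
      by (simp add: S f_def inner_sum_right inner_commute[of x] power2_eq_square mult.assoc)
    then show "0 \<le> x \<bullet> (S *v x)" for x
      by (simp add: sum_nonneg l0)
  qed
  moreover have "S ** S = Q"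
  proof -
    have "f (f x) = Q *v x" for x
    proof (rule linear_eq_on_span[where B = B and f = "f \<circ> f" and g = "(*v) Q", unfolded comp_def])
      show "linear (\<lambda>x. f (f x))" using linear_compose[OF lin lin] by (simp add: comp_def)
      show "f (f b) = Q *v b" if "b \<in> B" for b
        using that l0[of b] by (simp add: fb linear_cmul[OF lin] Qb flip: real_sqrt_mult)
      show "x \<in> span B" using B(4) by simp
    qed simp
    then show ?thesis by (simp add: matrix_eq S flip: matrix_vector_mul_assoc)
  qed
  ultimately show ?thesis by blast
qed

text \<open>If \<open>S\<close> and \<open>T\<close> are two positive semidefinite square roots of the same matrix and
  \<open>(S - T) b = \<lambda> b\<close>, then \<open>0 = b \<bullet> (S\<^sup>2 - T\<^sup>2) b = \<lambda> (b \<bullet> S b + b \<bullet> T b)\<close>, so \<open>\<lambda> \<noteq> 0\<close> would force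
  \<open>b \<bullet> S b = b \<bullet> T b = 0\<close> and hence \<open>\<lambda> = 0\<close>.\<close>

lemma possemidef_sqrt_unique:
  fixes S T :: "real^'n^'n"
  assumes S: "possemidef S" and T: "possemidef T" and eq: "S ** S = T ** T"
  shows "S = T"
proof -
  have sS: "(S *v x) \<bullet> y = x \<bullet> (S *v y)" and sT: "(T *v x) \<bullet> y = x \<bullet> (T *v y)" for x y
    using S T by (simp_all add: possemidef_def inner_symmetric_matrix)
  have sa: "((S - T) *v x) \<bullet> y = x \<bullet> ((S - T) *v y)" for x y
    by (simp add: matrix_vector_mult_diff_rdistrib inner_diff_left inner_diff_right sS sT)
  from self_adjoint_eigenbasis[of "(*v) (S - T)" UNIV] sa obtain B where
    B: "finite B" "\<forall>b\<in>B. norm b = 1 \<and> (S - T) *v b = (b \<bullet> ((S - T) *v b)) *\<^sub>R b" "span B = UNIV"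
    by auto
  have "(S - T) *v b = 0" if "b \<in> B" for b
  proof -
    define l where "l = b \<bullet> ((S - T) *v b)"
    have l: "S *v b - T *v b = l *\<^sub>R b" using B(2) that
      by (simp add: l_def flip: matrix_vector_mult_diff_rdistrib)
    have bb: "b \<bullet> b = 1" using B(2) that by (simp add: dot_square_norm)
    have S0: "0 \<le> b \<bullet> (S *v b)" and T0: "0 \<le> b \<bullet> (T *v b)" using S T by (simp_all add: possemidef_def)
    have "(S *v b) \<bullet> (S *v b) = (T *v b) \<bullet> (T *v b)"
      using eq by (metis matrix_vector_mul_assoc sS sT)
    then have "(S *v b - T *v b) \<bullet> (S *v b + T *v b) = 0"
      by (simp add: inner_diff_left inner_add_right inner_commute[of "T *v b" "S *v b"])
    then have "l * (b \<bullet> (S *v b) + b \<bullet> (T *v b)) = 0"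
      by (simp add: l inner_add_right distrib_left del: mult_eq_0_iff)
    then have "l = 0 \<or> b \<bullet> (S *v b) + b \<bullet> (T *v b) = 0" by (simp only: mult_eq_0_iff)
    moreover have "l = b \<bullet> (S *v b) - b \<bullet> (T *v b)"
      by (simp add: l_def matrix_vector_mult_diff_rdistrib inner_diff_right)
    ultimately have "l = 0" using S0 T0 by linarith
    then show ?thesis using l by (simp add: matrix_vector_mult_diff_rdistrib)
  qed
  then have "(S - T) *v x = 0" for x
    using linear_eq_on_span[of "(*v) (S - T)" "\<lambda>_. 0" B x] B(3) by (simp add: linear_zero)
  then have "S - T = 0" by (simp add: matrix_eq)
  then show ?thesis by simp
qed

lemma posdef_imp_possemidef: "posdef Q \<Longrightarrow> possemidef Q"
  unfolding posdef_def possemidef_def by (metis inner_zero_left order_less_imp_le order_refl)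

lemma
  assumes "possemidef Q"
  shows possemidef_msqrt: "possemidef (msqrt Q)" and msqrt_mult_msqrt: "msqrt Q ** msqrt Q = Q"
proof -
  have "\<exists>!S. possemidef S \<and> S ** S = Q"
    using possemidef_sqrt_exists[OF assms] possemidef_sqrt_unique by blast
  from theI'[OF this, folded msqrt_def]
  show "possemidef (msqrt Q)" "msqrt Q ** msqrt Q = Q" by auto
qed

lemma posdef_invertible:
  fixes Q :: "real^'n^'n"
  assumes "posdef Q"
  shows "invertible Q"
proof -
  have "x = 0" if "Q *v x = 0" for x
    using assms that unfolding posdef_def by (metis inner_zero_right less_irrefl)
  then show ?thesis
    by (simp add: invertible_left_inverse matrix_left_invertible_ker)
qed

lemma transpose_msqrt: "possemidef Q \<Longrightarrow> transpose (msqrt Q) = msqrt Q"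
  by (drule possemidef_msqrt) (simp only: possemidef_def)

lemma msqrt_eq_0_iff:
  fixes Q :: "real^'n^'n"
  assumes "posdef Q"
  shows "msqrt Q *v x = 0 \<longleftrightarrow> x = 0"
proof
  assume "msqrt Q *v x = 0"
  then have "Q *v x = 0"
    using msqrt_mult_msqrt[OF posdef_imp_possemidef[OF assms]]
    by (metis matrix_vector_mul_assoc matrix_vector_mult_0_right)
  then show "x = 0" using assms unfolding posdef_def by (metis inner_zero_right less_irrefl)
qed simp


section \<open>A Kalman-Yakubovich-Popov lemma\<close>

lemma bilinear_compose:
  assumes "bilinear \<beta>" "linear f" "linear g"
  shows "bilinear (\<lambda>u v. \<beta> (f u) (g v))"
proof -
  have "linear (\<lambda>v. \<beta> (f u) (g v))" for u
    using linear_compose[OF assms(3), of "\<beta> (f u)"] assms(1) by (simp add: bilinear_def comp_def)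
  moreover have "linear (\<lambda>u. \<beta> (f u) (g v))" for v
    using linear_compose[OF assms(2), of "\<lambda>x. \<beta> x (g v)"] assms(1) by (simp add: bilinear_def comp_def)
  ultimately show ?thesis by (simp add: bilinear_def)
qed

lemma bilinear_flip:
  assumes "bilinear \<beta>"
  shows "bilinear (\<lambda>u v. \<beta> v u)"
  using assms by (auto simp: bilinear_def)

lemma bilinear_plus:
  assumes "bilinear \<beta>" "bilinear \<beta>'"
  shows "bilinear (\<lambda>u v. \<beta> u v + \<beta>' u v)"
  using assms by (auto simp: bilinear_def intro!: linear_compose_add)

text \<open>Here \<open>\<beta> (x, y) (x, y)\<close> is a quadratic form in a state \<open>x\<close> and its velocity \<open>y\<close>, and \<open>freq\<close> says that it is
  nonnegative on the complex pairs \<open>(z, i \<omega> z)\<close>, \<open>z = u + i v\<close>. If \<open>y\<^sub>i = S x\<^sub>i\<close> with \<open>S\<close> skew-symmetric, then the claim is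
  the sum of these inequalities over an eigenbasis of the Hermitian map \<open>i S\<close>, written below as the real map
  \<open>(u, v) \<mapsto> (- S v, S u)\<close>. The deviations \<open>y\<^sub>i - S x\<^sub>i\<close> are uncorrelated with the \<open>x\<^sub>i\<close> and only contribute
  through \<open>at_infinity\<close>.\<close>

lemma sum_form_nonneg_normalized:
  fixes \<beta> :: "('a::euclidean_space \<times> 'a) \<Rightarrow> ('a \<times> 'a) \<Rightarrow> real"
  assumes bil: "bilinear \<beta>"
    and freq: "\<And>\<omega> u v. 0 \<le> \<beta> (u, - (\<omega> *\<^sub>R v)) (u, - (\<omega> *\<^sub>R v)) + \<beta> (v, \<omega> *\<^sub>R u) (v, \<omega> *\<^sub>R u)"
    and at_infinity: "\<And>y. 0 \<le> \<beta> (0, y) (0, y)"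
    and skew: "\<And>u v. (\<Sum>i\<in>I. (u \<bullet> x i) * (v \<bullet> y i) + (v \<bullet> x i) * (u \<bullet> y i)) = 0"
    and pars: "\<And>u v. (\<Sum>i\<in>I. (u \<bullet> x i) * (v \<bullet> x i)) = u \<bullet> v"
  shows "0 \<le> (\<Sum>i\<in>I. \<beta> (x i, y i) (x i, y i))"
proof -
  define S where "S u = (\<Sum>i\<in>I. (u \<bullet> x i) *\<^sub>R y i)" for u
  have linS: "linear S"
    by (rule linearI) (simp_all add: S_def inner_add_left scaleR_add_left sum.distrib scaleR_sum_right)
  have Sskew: "S u \<bullet> v = - (u \<bullet> S v)" for u v
  proof -
    have "S u \<bullet> v + S v \<bullet> u = 0"
      using skew[of u v] by (simp add: S_def inner_sum_left sum.distrib inner_commute[of v] inner_commute[of u])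
    then show ?thesis by (simp add: inner_commute)
  qed
  define r where "r i = y i - S (x i)" for i
  have xr: "(\<Sum>i\<in>I. (u \<bullet> x i) *\<^sub>R r i) = 0" for u
  proof -
    have "(\<Sum>i\<in>I. (u \<bullet> x i) *\<^sub>R x i) \<bullet> v = u \<bullet> v" for v
      using pars[of u v] by (simp add: inner_sum_left inner_commute[of v])
    then have "(\<Sum>i\<in>I. (u \<bullet> x i) *\<^sub>R x i) = u" using vector_eq_rdot by blast
    then have "S u = S (\<Sum>i\<in>I. (u \<bullet> x i) *\<^sub>R x i)" by simp
    also have "\<dots> = (\<Sum>i\<in>I. (u \<bullet> x i) *\<^sub>R S (x i))"
      by (simp add: linear_sum[OF linS] linear_cmul[OF linS])
    finally show ?thesis
      by (simp add: r_def scaleR_diff_right sum_subtractf flip: S_def)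
  qed
  have lin1: "linear (\<lambda>u. (u, S u))" and lin2: "linear (\<lambda>u::'a. (0::'a, u))"
    by (auto intro!: linearI simp: linear_add[OF linS] linear_cmul[OF linS])
  define p where "p u v = \<beta> (u, S u) (v, S v)" for u v
  have bilp: "bilinear p"
    using bilinear_compose[OF bil lin1 lin1] by (simp add: p_def[abs_def])
  define c where "c u v = \<beta> (u, S u) (0, v) + \<beta> (0, v) (u, S u)" for u v
  have bilc: "bilinear c"
    using bilinear_plus[OF bilinear_compose[OF bil lin1 lin2] bilinear_flip[OF bilinear_compose[OF bil lin2 lin1]]]
    by (simp add: c_def[abs_def])
  have "(\<Sum>i\<in>I. c (x i) (r i)) = 0"
  proof -
    have "c (x i) (r i) = (\<Sum>e\<in>Basis. c e ((e \<bullet> x i) *\<^sub>R r i))" for i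
    proof -
      have "c (x i) (r i) = c (\<Sum>e\<in>Basis. (e \<bullet> x i) *\<^sub>R e) (r i)"
        by (simp add: euclidean_representation inner_commute[of _ "x i"])
      also have "\<dots> = (\<Sum>e\<in>Basis. c ((e \<bullet> x i) *\<^sub>R e) (r i))"
        using bilc linear_sum unfolding bilinear_def by blast
      finally show ?thesis by (simp add: bilinear_lmul[OF bilc] bilinear_rmul[OF bilc])
    qed
    then have "(\<Sum>i\<in>I. c (x i) (r i)) = (\<Sum>e\<in>Basis. \<Sum>i\<in>I. c e ((e \<bullet> x i) *\<^sub>R r i))"
      by (simp add: sum.swap[of _ I])
    also have "\<dots> = (\<Sum>e\<in>Basis. c e (\<Sum>i\<in>I. (e \<bullet> x i) *\<^sub>R r i))"
      using bilc linear_sum[of "c _"] unfolding bilinear_def by (metis (no_types, lifting) sum.cong)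
    finally show ?thesis by (simp add: xr bilinear_rzero[OF bilc])
  qed
  moreover have "\<beta> (x i, y i) (x i, y i) = p (x i) (x i) + c (x i) (r i) + \<beta> (0, r i) (0, r i)" for i
  proof -
    have "(x i, y i) = (x i, S (x i)) + (0, r i)" by (simp add: r_def)
    then show ?thesis
      by (simp only: bilinear_ladd[OF bil] bilinear_radd[OF bil] p_def c_def add_ac)
  qed
  ultimately have "(\<Sum>i\<in>I. \<beta> (x i, y i) (x i, y i)) = (\<Sum>i\<in>I. p (x i) (x i)) + (\<Sum>i\<in>I. \<beta> (0, r i) (0, r i))"
    by (simp add: sum.distrib)
  moreover have "0 \<le> (\<Sum>i\<in>I. \<beta> (0, r i) (0, r i))" by (intro sum_nonneg at_infinity)
  moreover have "(\<Sum>i\<in>I. p (x i) (x i)) = (\<Sum>e\<in>Basis. p e e)"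
    by (rule sum_bilinear_second_moments[OF bilp]) (simp add: pars euclidean_inner[symmetric])
  moreover have "0 \<le> (\<Sum>e\<in>Basis. p e e)"
  proof -
    define h where "h z = (- S (snd z), S (fst z))" for z
    have linh: "linear h"
      by (rule linearI) (auto simp: h_def linear_add[OF linS] linear_cmul[OF linS])
    have hsa: "h z \<bullet> w = z \<bullet> h w" for z w
      by (simp add: h_def inner_prod_def Sskew)
    from self_adjoint_eigenbasis[OF linh hsa, of UNIV] obtain B where
      B: "finite B" "pairwise orthogonal B" "\<And>b. b \<in> B \<Longrightarrow> norm b = 1 \<and> h b = (b \<bullet> h b) *\<^sub>R b" "span B = UNIV"
      by auto
    define P where "P z w = p (fst z) (fst w) + p (snd z) (snd w)" for z w
    have bilP: "bilinear P"
      using bilinear_plus[OF bilinear_compose[OF bilp linear_fst linear_fst] bilinear_compose[OF bilp linear_snd linear_snd]]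
      by (simp add: P_def[abs_def])
    have "(\<Sum>b\<in>B. P b b) = (\<Sum>b\<in>Basis. P b b)"
    proof (rule sum_bilinear_second_moments[OF bilP])
      fix z w
      show "(\<Sum>b\<in>B. (z \<bullet> b) * (w \<bullet> b)) = (\<Sum>b\<in>Basis. (z \<bullet> b) * (w \<bullet> b))"
      proof -
        have "(\<Sum>b\<in>B. (z \<bullet> b) * (w \<bullet> b)) = (\<Sum>b\<in>B. (b \<bullet> z) * (b \<bullet> w))"
          by (intro sum.cong refl arg_cong2[where f = "(*)"] inner_commute)
        also have "\<dots> = z \<bullet> w" by (rule orthonormal_parseval) (use B in auto)
        finally show ?thesis by (simp only: euclidean_inner[of z w])
      qed
    qed
    also have "\<dots> = 2 * (\<Sum>e\<in>Basis. p e e)"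
    proof -
      have "(\<Sum>b\<in>Basis. P b b) = (\<Sum>b\<in>(\<lambda>u. (u, 0)) ` Basis. P b b) + (\<Sum>b\<in>(\<lambda>u. (0, u)) ` Basis. P b b)"
        unfolding Basis_prod_def by (rule sum.union_disjoint) auto
      then show ?thesis
        by (simp add: sum.reindex inj_on_def P_def bilinear_lzero[OF bilp])
    qed
    finally have eq: "(\<Sum>b\<in>B. P b b) = 2 * (\<Sum>e\<in>Basis. p e e)" .
    have "0 \<le> P b b" if b: "b \<in> B" for b
    proof -
      obtain u v where uv: "b = (u, v)" by (cases b)
      define l where "l = b \<bullet> h b"
      have "h b = l *\<^sub>R b" using B(3)[OF b] by (simp add: l_def)
      then have "S u = l *\<^sub>R v" "S v = - (l *\<^sub>R u)" by (auto simp: h_def uv) (metis minus_minus)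
      then show ?thesis using freq[of v l u] by (simp add: P_def p_def uv)
    qed
    then have "0 \<le> (\<Sum>b\<in>B. P b b)" by (intro sum_nonneg)
    then show ?thesis using eq by simp
  qed
  ultimately show ?thesis by linarith
qed

text \<open>The square root of the second-moment matrix \<open>\<Sum> x\<^sub>i x\<^sub>i\<^sup>T\<close> is a change of coordinates that turns it into the
  identity and respects the other hypotheses.\<close>

lemma sum_form_nonneg_posdef:
  fixes \<beta> :: "((real^'n) \<times> (real^'n)) \<Rightarrow> ((real^'n) \<times> (real^'n)) \<Rightarrow> real"
  assumes bil: "bilinear \<beta>"
    and freq: "\<And>\<omega> u v. 0 \<le> \<beta> (u, - (\<omega> *\<^sub>R v)) (u, - (\<omega> *\<^sub>R v)) + \<beta> (v, \<omega> *\<^sub>R u) (v, \<omega> *\<^sub>R u)"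
    and at_infinity: "\<And>y. 0 \<le> \<beta> (0, y) (0, y)"
    and skew: "\<And>u v. (\<Sum>i\<in>I. (u \<bullet> x i) * (v \<bullet> y i) + (v \<bullet> x i) * (u \<bullet> y i)) = 0"
    and pd: "\<And>u. u \<noteq> 0 \<Longrightarrow> 0 < (\<Sum>i\<in>I. (u \<bullet> x i)\<^sup>2)"
  shows "0 \<le> (\<Sum>i\<in>I. \<beta> (x i, y i) (x i, y i))"
proof -
  define D where "D = matrix (\<lambda>u. \<Sum>i\<in>I. (u \<bullet> x i) *\<^sub>R x i)"
  have D: "D *v u = (\<Sum>i\<in>I. (u \<bullet> x i) *\<^sub>R x i)" for u
  proof -
    have "linear (\<lambda>u. \<Sum>i\<in>I. (u \<bullet> x i) *\<^sub>R x i)"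
      by (rule linearI) (simp_all add: inner_add_left scaleR_add_left sum.distrib scaleR_sum_right)
    then show ?thesis by (simp add: D_def matrix_works)
  qed
  have "transpose D = D"
    by (rule symmetric_matrixI) (simp add: D inner_sum_left inner_sum_right inner_commute mult.commute)
  moreover have "u \<bullet> (D *v u) = (\<Sum>i\<in>I. (u \<bullet> x i)\<^sup>2)" for u
    by (simp add: D inner_sum_right power2_eq_square)
  ultimately have Dpd: "posdef D" using pd by (simp add: posdef_def)
  define L where "L = msqrt D"
  have LL: "L ** L = D" unfolding L_def by (rule msqrt_mult_msqrt[OF posdef_imp_possemidef[OF Dpd]])
  have sL: "(L *v a) \<bullet> b = a \<bullet> (L *v b)" for a b
    unfolding L_def by (rule inner_symmetric_matrix[OF transpose_msqrt[OF posdef_imp_possemidef[OF Dpd]]])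
  have "invertible L"
    using msqrt_eq_0_iff[OF Dpd] by (simp add: invertible_left_inverse matrix_left_invertible_ker L_def)
  then obtain L' where L': "L ** L' = mat 1" "L' ** L = mat 1" by (auto simp: invertible_def)
  have LL': "L *v (L' *v a) = a" for a by (simp add: matrix_vector_mul_assoc L')
  have sL': "(L' *v a) \<bullet> b = a \<bullet> (L' *v b)" for a b
    by (metis LL' sL)
  define \<beta>' where "\<beta>' z w = \<beta> (L *v fst z, L *v snd z) (L *v fst w, L *v snd w)" for z w
  have linL: "linear (\<lambda>z. (L *v fst z, L *v snd z))"
    by (rule linearI) (simp_all add: matrix_vector_right_distrib matrix_vector_mult_scaleR)
  have "0 \<le> (\<Sum>i\<in>I. \<beta>' (L' *v x i, L' *v y i) (L' *v x i, L' *v y i))"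
  proof (rule sum_form_nonneg_normalized[where \<beta> = \<beta>' and x = "\<lambda>i. L' *v x i" and y = "\<lambda>i. L' *v y i"])
    show "bilinear \<beta>'" using bilinear_compose[OF bil linL linL] by (simp add: \<beta>'_def[abs_def])
    show "0 \<le> \<beta>' (u, - (\<omega> *\<^sub>R v)) (u, - (\<omega> *\<^sub>R v)) + \<beta>' (v, \<omega> *\<^sub>R u) (v, \<omega> *\<^sub>R u)" for \<omega> u v
      using freq[of "L *v u" \<omega> "L *v v"]
      by (simp add: \<beta>'_def matrix_vector_mult_scaleR linear_neg[OF matrix_vector_mul_linear])
    show "0 \<le> \<beta>' (0, w) (0, w)" for w using at_infinity by (simp add: \<beta>'_def)
    show "(\<Sum>i\<in>I. (u \<bullet> (L' *v x i)) * (v \<bullet> (L' *v y i)) + (v \<bullet> (L' *v x i)) * (u \<bullet> (L' *v y i))) = 0" for u v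
      using skew[of "L' *v u" "L' *v v"] by (simp add: sL')
    show "(\<Sum>i\<in>I. (u \<bullet> (L' *v x i)) * (v \<bullet> (L' *v x i))) = u \<bullet> v" for u v
    proof -
      have "(\<Sum>i\<in>I. (u \<bullet> (L' *v x i)) * (v \<bullet> (L' *v x i))) = (L' *v v) \<bullet> (D *v (L' *v u))"
        by (simp add: D inner_sum_right sL' mult.commute)
      also have "\<dots> = (L' *v v) \<bullet> (L *v u)"
        by (simp add: LL' flip: LL matrix_vector_mul_assoc)
      also have "\<dots> = u \<bullet> v" by (metis LL' sL inner_commute)
      finally show ?thesis .
    qed
  qed
  then show ?thesis by (simp add: \<beta>'_def LL')
qed

lemma sum_form_nonneg:
  fixes \<beta> :: "((real^'n) \<times> (real^'n)) \<Rightarrow> ((real^'n) \<times> (real^'n)) \<Rightarrow> real"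
  assumes fin: "finite I" and bil: "bilinear \<beta>"
    and freq: "\<And>\<omega> u v. 0 \<le> \<beta> (u, - (\<omega> *\<^sub>R v)) (u, - (\<omega> *\<^sub>R v)) + \<beta> (v, \<omega> *\<^sub>R u) (v, \<omega> *\<^sub>R u)"
    and at_infinity: "\<And>y. 0 \<le> \<beta> (0, y) (0, y)"
    and skew: "\<And>u v. (\<Sum>i\<in>I. (u \<bullet> x i) * (v \<bullet> y i) + (v \<bullet> x i) * (u \<bullet> y i)) = 0"
  shows "0 \<le> (\<Sum>i\<in>I. \<beta> (x i, y i) (x i, y i))"
proof (rule field_le_epsilon)
  fix \<epsilon> :: real assume \<epsilon>: "0 < \<epsilon>"
  define N where "N = (\<Sum>e\<in>Basis. \<beta> (e, 0) (e, 0))"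
  define d where "d = \<epsilon> / (1 + \<bar>N\<bar>)"
  have d: "0 < d" using \<epsilon> by (simp add: d_def divide_pos_pos add_pos_nonneg)
  \<comment> \<open>Adjoining the equilibria \<open>(\<surd>d e, 0)\<close> keeps the skewness and makes the second moments of the states positive definite.\<close>
  define x' where "x' = case_sum x (\<lambda>e. sqrt d *\<^sub>R e)"
  define y' where "y' = case_sum y (\<lambda>_ :: real^'n. 0)"
  have "0 \<le> (\<Sum>i\<in>I <+> Basis. \<beta> (x' i, y' i) (x' i, y' i))"
  proof (rule sum_form_nonneg_posdef[OF bil freq at_infinity])
    show "(\<Sum>i\<in>I <+> Basis. (u \<bullet> x' i) * (v \<bullet> y' i) + (v \<bullet> x' i) * (u \<bullet> y' i)) = 0" for u v
      by (simp add: sum.Plus fin x'_def y'_def skew)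
    show "0 < (\<Sum>i\<in>I <+> Basis. (u \<bullet> x' i)\<^sup>2)" if "u \<noteq> 0" for u
    proof -
      have "(\<Sum>e\<in>Basis. (u \<bullet> (sqrt d *\<^sub>R e))\<^sup>2) = (\<Sum>e\<in>Basis. d * (u \<bullet> e)\<^sup>2)"
        using d by (simp add: power_mult_distrib)
      also have "\<dots> = d * (u \<bullet> u)"
        by (simp add: euclidean_inner[of u u] sum_distrib_left power2_eq_square)
      finally have "(\<Sum>e\<in>Basis. (u \<bullet> (sqrt d *\<^sub>R e))\<^sup>2) = d * (u \<bullet> u)" .
      moreover have "0 < d * (u \<bullet> u)" using d that by simp
      ultimately show ?thesis by (simp add: sum.Plus fin x'_def add_nonneg_pos sum_nonneg)
    qed
  qed
  also have "\<dots> = (\<Sum>i\<in>I. \<beta> (x i, y i) (x i, y i)) + d * N"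
  proof -
    have "\<beta> (sqrt d *\<^sub>R e, 0) (sqrt d *\<^sub>R e, 0) = d * \<beta> (e, 0) (e, 0)" for e
      using bilinear_lmul[OF bil, of "sqrt d" "(e, 0)"] bilinear_rmul[OF bil, of _ "sqrt d" "(e, 0)"] d
      by simp
    then show ?thesis by (simp add: sum.Plus fin x'_def y'_def N_def sum_distrib_left)
  qed
  also have "d * N \<le> \<epsilon>"
  proof -
    have "d * N \<le> d * (1 + \<bar>N\<bar>)" using d by (intro mult_left_mono) auto
    then show ?thesis by (simp add: d_def)
  qed
  finally show "0 \<le> (\<Sum>i\<in>I. \<beta> (x i, y i) (x i, y i)) + \<epsilon>" by simp
qed


text \<open>The outer product \<open>x y\<^sup>T\<close>.\<close>

definition outer :: "real^'n \<Rightarrow> real^'n \<Rightarrow> real^'n^'n" where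
  "outer x y = (\<chi> i j. x $ i * y $ j)"

lemma inner_outer: "Z \<bullet> outer x y = x \<bullet> (Z *v y)"
  by (simp add: outer_def inner_vec_def matrix_vector_mult_def sum_distrib_left mult_ac)

lemma inner_outer_mult: "u \<bullet> (outer x y *v v) = (u \<bullet> x) * (v \<bullet> y)"
proof -
  have "outer x y *v v = (v \<bullet> y) *\<^sub>R x"
    by (simp add: vec_eq_iff outer_def inner_vec_def matrix_vector_mult_def sum_distrib_left mult_ac)
  then show ?thesis by (simp add: mult.commute)
qed

text \<open>By \<open>sum_form_nonneg\<close>, the point \<open>(- 1, 0)\<close> lies outside the convex cone of the pairs
  \<open>(\<Sum>\<^sub>i \<beta> (x\<^sub>i, y\<^sub>i) (x\<^sub>i, y\<^sub>i), V)\<close> with \<open>V + V\<^sup>T = \<Sum>\<^sub>i (x\<^sub>i y\<^sub>i\<^sup>T + y\<^sub>i x\<^sub>i\<^sup>T)\<close>. The normal of a separating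
  hyperplane is a multiple of \<open>(1, - 2 Z)\<close>. Its matrix part is symmetric because every skew-symmetric \<open>V\<close> occurs
  with first coordinate 0, and its first coordinate does not vanish because \<open>x \<bullet> Z y \<ge> 0\<close> for all \<open>x\<close> and \<open>y\<close>
  would force \<open>Z = 0\<close>.\<close>

lemma kyp:
  fixes \<beta> :: "((real^'n) \<times> (real^'n)) \<Rightarrow> ((real^'n) \<times> (real^'n)) \<Rightarrow> real"
  assumes bil: "bilinear \<beta>"
    and freq: "\<And>\<omega> u v. 0 \<le> \<beta> (u, - (\<omega> *\<^sub>R v)) (u, - (\<omega> *\<^sub>R v)) + \<beta> (v, \<omega> *\<^sub>R u) (v, \<omega> *\<^sub>R u)"
    and at_infinity: "\<And>y. 0 \<le> \<beta> (0, y) (0, y)"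
  obtains Z where "transpose Z = Z" "\<And>x y. 2 * (x \<bullet> (Z *v y)) \<le> \<beta> (x, y) (x, y)"
proof -
  define m where "m l u v = (\<Sum>z\<leftarrow>l. (u \<bullet> fst z) * (v \<bullet> snd z) + (v \<bullet> fst z) * (u \<bullet> snd z))"
    for l :: "((real^'n) \<times> (real^'n)) list" and u v
  define C where "C = {(r, V). \<exists>l. r = (\<Sum>z\<leftarrow>l. \<beta> z z) \<and> (\<forall>u v. u \<bullet> (V *v v) + v \<bullet> (V *v u) = m l u v)}"
  have C_I: "((\<Sum>z\<leftarrow>l. \<beta> z z), V) \<in> C" if "\<And>u v. u \<bullet> (V *v v) + v \<bullet> (V *v u) = m l u v" for l V
    using that by (auto simp: C_def)
  have C_add: "p + q \<in> C" if pq: "p \<in> C" "q \<in> C" for p q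
  proof -
    obtain l V l' V' where
      "p = ((\<Sum>z\<leftarrow>l. \<beta> z z), V)" "\<And>u v. u \<bullet> (V *v v) + v \<bullet> (V *v u) = m l u v"
      "q = ((\<Sum>z\<leftarrow>l'. \<beta> z z), V')" "\<And>u v. u \<bullet> (V' *v v) + v \<bullet> (V' *v u) = m l' u v"
      using pq by (auto simp: C_def)
    moreover from this have "u \<bullet> ((V + V') *v v) + v \<bullet> ((V + V') *v u) = m (l @ l') u v" for u v
      by (simp add: m_def matrix_vector_mult_add_rdistrib inner_add_right flip: add.assoc) (simp add: algebra_simps)
    ultimately show ?thesis using C_I[of "V + V'" "l @ l'"] by simp
  qed
  have C_scale: "c *\<^sub>R p \<in> C" if p: "p \<in> C" and c: "0 \<le> c" for p c
  proof -
    obtain l V where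
      lV: "p = ((\<Sum>z\<leftarrow>l. \<beta> z z), V)" "\<And>u v. u \<bullet> (V *v v) + v \<bullet> (V *v u) = m l u v"
      using p by (auto simp: C_def)
    define l' where "l' = map ((*\<^sub>R) (sqrt c)) l"
    have "m l' u v = c * m l u v" for u v
    proof -
      have sc: "(sqrt c * a) * (sqrt c * b) = c * (a * b)" for a b :: real
        using c by (simp add: mult_ac flip: mult.assoc[of "sqrt c" "sqrt c"])
      show ?thesis by (simp add: m_def l'_def o_def sc flip: sum_list_const_mult distrib_left)
    qed
    moreover have "(\<Sum>z\<leftarrow>l'. \<beta> z z) = c * (\<Sum>z\<leftarrow>l. \<beta> z z)"
      using c by (simp add: l'_def o_def bilinear_lmul[OF bil] bilinear_rmul[OF bil] flip: sum_list_const_mult mult.assoc)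
    ultimately show ?thesis using C_I[of "c *\<^sub>R V" l'] lV
      by (simp add: scaleR_matrix_vector_assoc[symmetric] flip: distrib_left)
  qed
  have zero: "(0, V) \<in> C" if "\<And>u v. u \<bullet> (V *v v) + v \<bullet> (V *v u) = 0" for V
    using C_I[of V "[]"] that by (simp add: m_def)
  have one: "(\<beta> (x, y) (x, y), outer x y) \<in> C" for x y
    using C_I[of "outer x y" "[(x, y)]"] by (simp add: m_def inner_outer_mult)
  have "(-1, 0) \<notin> C"
  proof
    assume "(-1, 0) \<in> C"
    then obtain l where l: "-1 = (\<Sum>z\<leftarrow>l. \<beta> z z)" "\<And>u v. m l u v = 0" by (auto simp: C_def)
    have "0 \<le> (\<Sum>i\<in>{0..<length l}. \<beta> (fst (l ! i), snd (l ! i)) (fst (l ! i), snd (l ! i)))"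
      using l(2) by (intro sum_form_nonneg[OF _ bil freq at_infinity]) (simp_all add: m_def sum_list_sum_nth)
    then show False using l(1) by (simp add: sum_list_sum_nth)
  qed
  moreover have "convex C"
    by (intro convexI C_add C_scale)
  moreover have "C \<noteq> {}" using zero[of 0] by auto
  ultimately obtain n b where n: "n \<noteq> 0" "n \<bullet> (-1, 0) \<le> b" "\<forall>p\<in>C. b \<le> n \<bullet> p"
    using separating_hyperplane_sets[of "{(-1, 0)}" C] by auto
  obtain a Z where aZ: "n = (a, Z)" by (cases n)
  \<comment> \<open>A functional that is bounded below on a cone is nonnegative on it.\<close>
  have nonneg: "0 \<le> a * fst p + Z \<bullet> snd p" if p: "p \<in> C" for p
  proof (rule ccontr)
    define k where "k = - (a * fst p + Z \<bullet> snd p)"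
    assume "\<not> ?thesis"
    then have k: "0 < k" by (simp add: k_def)
    define c where "c = (\<bar>b\<bar> + 1) / k"
    have "c *\<^sub>R p \<in> C" using k by (intro C_scale p) (simp add: c_def)
    then have "b \<le> - (c * k)"
      using n(3) aZ by (force simp: inner_prod_def k_def algebra_simps)
    then show False using k by (simp add: c_def)
  qed
  have "(0, 0) \<in> C" by (rule zero) simp
  then have "b \<le> n \<bullet> (0, 0)" using n(3) by blast
  then have "b \<le> 0" by (simp add: aZ)
  then have a0: "0 \<le> a" using n(2) aZ by simp
  have form: "0 \<le> a * \<beta> (x, y) (x, y) + x \<bullet> (Z *v y)" for x y
    using nonneg[OF one[of x y]] by (simp add: inner_outer)
  have Zsym: "transpose Z = Z"
  proof -
    define V where "V = transpose Z - Z"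
    have V: "u \<bullet> (V *v v) + v \<bullet> (V *v u) = 0" for u v
      by (simp add: V_def matrix_vector_mult_diff_rdistrib inner_diff_right inner_commute[of _ "_ v* _"] dot_lmul_matrix)
    from nonneg[OF zero[of V]] V have "0 \<le> Z \<bullet> V" by simp
    moreover have tr: "transpose M \<bullet> N = M \<bullet> transpose N" for M N :: "real^'n^'n"
      unfolding inner_vec_def transpose_def by (simp, rule sum.swap)
    ultimately have "0 \<le> Z \<bullet> (transpose Z) - Z \<bullet> Z" by (simp add: V_def inner_diff_right)
    moreover have "V \<bullet> V = 2 * (Z \<bullet> Z) - 2 * (Z \<bullet> transpose Z)"
      by (simp add: V_def inner_diff_left inner_diff_right tr inner_commute)
    ultimately have "V \<bullet> V \<le> 0" by simp
    then have "V = 0" by (metis inner_gt_zero_iff not_le)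
    then show ?thesis by (simp add: V_def)
  qed
  have "a \<noteq> 0"
  proof
    assume "a = 0"
    then have "0 \<le> - ((Z *v y) \<bullet> (Z *v y))" for y using form[of "- (Z *v y)" y] by simp
    then have "Z *v y = 0" for y by (metis inner_gt_zero_iff neg_0_le_iff_le not_le)
    then have "Z = 0" by (simp add: matrix_eq)
    then show False using n(1) aZ \<open>a = 0\<close> by (simp add: zero_prod_def)
  qed
  then have a: "0 < a" using a0 by simp
  show thesis
  proof (rule that[of "(- 1 / (2 * a)) *\<^sub>R Z"])
    show "transpose ((- 1 / (2 * a)) *\<^sub>R Z) = (- 1 / (2 * a)) *\<^sub>R Z"
      by (simp only: transpose_scalar Zsym)
    show "2 * (x \<bullet> ((- 1 / (2 * a)) *\<^sub>R Z *v y)) \<le> \<beta> (x, y) (x, y)" for x y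
    proof -
      have "(k *\<^sub>R Z) *v y = k *\<^sub>R (Z *v y)" for k by (simp add: scaleR_matrix_vector_assoc)
      then show ?thesis using form[of x y] a by (simp add: field_simps del: scaleR_minus_left)
    qed
  qed
qed


section \<open>Complex vectors and real matrices\<close>

text \<open>The real and the imaginary part of a complex vector, taken entrywise, and the vector \<open>u + i v\<close>. They reduce
  statements about real matrices acting on complex vectors to real vectors.\<close>

definition re_vec :: "complex^'n \<Rightarrow> real^'n" where
  "re_vec z = (\<chi> i. Re (z $ i))"

definition im_vec :: "complex^'n \<Rightarrow> real^'n" where
  "im_vec z = (\<chi> i. Im (z $ i))"

definition cvec :: "real^'n \<Rightarrow> real^'n \<Rightarrow> complex^'n" where
  "cvec u v = (\<chi> i. Complex (u $ i) (v $ i))"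

lemma re_im_cvec [simp]: "re_vec (cvec u v) = u" "im_vec (cvec u v) = v"
  by (simp_all add: re_vec_def im_vec_def cvec_def vec_eq_iff)

lemma re_im_vec_simps [simp]:
  "re_vec (x + y) = re_vec x + re_vec y" "im_vec (x + y) = im_vec x + im_vec y"
  "re_vec (x - y) = re_vec x - re_vec y" "im_vec (x - y) = im_vec x - im_vec y"
  "re_vec (r *\<^sub>R x) = r *\<^sub>R re_vec x" "im_vec (r *\<^sub>R x) = r *\<^sub>R im_vec x"
  "re_vec 0 = 0" "im_vec 0 = 0"
  by (simp_all add: re_vec_def im_vec_def vec_eq_iff)

lemma re_im_vec_smult:
  "re_vec (c *s x) = Re c *\<^sub>R re_vec x - Im c *\<^sub>R im_vec x"
  "im_vec (c *s x) = Re c *\<^sub>R im_vec x + Im c *\<^sub>R re_vec x"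
  by (simp_all add: re_vec_def im_vec_def vec_eq_iff)

lemma complex_vec_eq_iff: "x = y \<longleftrightarrow> re_vec x = re_vec y \<and> im_vec x = im_vec y"
  by (auto simp: re_vec_def im_vec_def vec_eq_iff complex_eq_iff)

lemma inner_complex_vec: "x \<bullet> y = re_vec x \<bullet> re_vec y + im_vec x \<bullet> im_vec y"
  by (simp add: re_vec_def im_vec_def inner_vec_def inner_complex_def sum.distrib)

lemma norm_complex_vec: "(norm x)\<^sup>2 = (norm (re_vec x))\<^sup>2 + (norm (im_vec x))\<^sup>2"
  by (simp add: inner_complex_vec flip: dot_square_norm)

lemma re_im_cmat [simp]:
  "re_vec (cmat A *v x) = A *v re_vec x" "im_vec (cmat A *v x) = A *v im_vec x"
  by (simp_all add: re_vec_def im_vec_def vec_eq_iff matrix_vector_mult_def)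

lemma smult_conv_scaleR: "c *s (x :: complex^'n) = Re c *\<^sub>R x + Im c *\<^sub>R (\<i> *s x)"
  by (simp add: complex_vec_eq_iff re_im_vec_smult)

section \<open>Polynomials of a matrix and eigenvectors\<close>

text \<open>\<open>mat_poly_app M p v\<close> is \<open>p(M) v\<close>.\<close>

definition mat_poly_app :: "complex^'n^'n \<Rightarrow> complex poly \<Rightarrow> complex^'n \<Rightarrow> complex^'n" where
  "mat_poly_app M p v = fold_coeffs (\<lambda>a w. a *s v + M *v w) p 0"

lemma mat_poly_app_0 [simp]: "mat_poly_app M 0 v = 0"
  by (simp add: mat_poly_app_def)

lemma mat_poly_app_pCons [simp]: "mat_poly_app M (pCons a p) v = a *s v + M *v mat_poly_app M p v"
  by (cases "a = 0 \<and> p = 0") (auto simp: mat_poly_app_def)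

lemma mat_poly_app_add: "mat_poly_app M (p + q) v = mat_poly_app M p v + mat_poly_app M q v"
  by (induction p q rule: poly_induct2)
    (simp_all add: matrix_vector_right_distrib vector_sadd_rdistrib add_ac)

lemma mat_poly_app_smult: "mat_poly_app M (smult c p) v = c *s mat_poly_app M p v"
  by (induction p) (simp_all add: vec.scale_right_distrib vec.linear_scale[OF matrix_vector_mul_linear_gen])

lemma mat_poly_app_linear_factor:
  "mat_poly_app M ([:-c, 1:] * q) v = M *v mat_poly_app M q v - c *s mat_poly_app M q v"
proof -
  have "[:-c, 1:] * q = smult (- c) q + pCons 0 q" by simp
  then show ?thesis by (simp only: mat_poly_app_add mat_poly_app_smult mat_poly_app_pCons) simp
qed

lemma mat_poly_app_eigenvector:
  assumes "M *v v = \<mu> *s v"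
  shows "mat_poly_app M p v = poly p \<mu> *s v"
  by (induction p) (simp_all add: vec.linear_scale[OF matrix_vector_mul_linear_gen] assms vec.scale_left_distrib mult.commute)

lemma mat_poly_app_monom: "mat_poly_app M (monom c k) v = c *s (((**) M ^^ k) (mat 1) *v v)"
  by (induction k)
    (simp_all add: monom_Suc monom_0 vec.linear_scale[OF matrix_vector_mul_linear_gen] flip: matrix_vector_mul_assoc)

lemma mat_poly_app_sum: "mat_poly_app M (\<Sum>i\<in>I. p i) v = (\<Sum>i\<in>I. mat_poly_app M (p i) v)"
  by (induction I rule: infinite_finite_induct) (simp_all add: mat_poly_app_add)

lemma annihilating_poly:
  fixes M :: "complex^'n^'n"
  obtains p where "p \<noteq> 0" "\<And>v. mat_poly_app M p v = 0"
proof -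
  define D where "D = DIM(complex^'n^'n)"
  \<comment> \<open>\<open>D + 1\<close> powers of \<open>M\<close> are linearly dependent, even over the reals.\<close>
  define P where "P k = ((**) M ^^ k) (mat 1)" for k
  have "\<exists>w :: nat \<Rightarrow> real. (\<exists>k\<le>D. w k \<noteq> 0) \<and> (\<Sum>k\<le>D. w k *\<^sub>R P k) = 0"
  proof (cases "inj_on P {..D}")
    case True
    then have "card (P ` {..D}) = D + 1" by (simp add: card_image)
    then have "dependent (P ` {..D})" by (intro dependent_biggerset) (simp add: D_def)
    then obtain u where "\<exists>v\<in>P ` {..D}. u v \<noteq> 0" "(\<Sum>v\<in>P ` {..D}. u v *\<^sub>R v) = 0"
      by (auto simp: dependent_finite)
    then show ?thesis using True
      by (intro exI[of _ "\<lambda>k. u (P k)"]) (auto simp: sum.reindex)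
  next
    case False
    then obtain i j where ij: "i \<le> D" "j \<le> D" "i \<noteq> j" "P i = P j" by (auto simp: inj_on_def)
    define w :: "nat \<Rightarrow> real" where "w k = (if k = i then 1 else 0) - (if k = j then 1 else 0)" for k
    have "(\<Sum>k\<le>D. w k *\<^sub>R P k) = (\<Sum>k\<le>D. if k = i then P k else 0) - (\<Sum>k\<le>D. if k = j then P k else 0)"
      unfolding sum_subtractf[symmetric] by (rule sum.cong[OF refl]) (simp add: w_def)
    also have "\<dots> = 0" using ij by simp
    finally show ?thesis using ij by (intro exI[of _ w]) (auto simp: w_def)
  qed
  then obtain w :: "nat \<Rightarrow> real" and k where w: "k \<le> D" "w k \<noteq> 0" "(\<Sum>k\<le>D. w k *\<^sub>R P k) = 0" by auto
  define p where "p = (\<Sum>k\<le>D. monom (complex_of_real (w k)) k)"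
  have "coeff p k = of_real (w k)" using w(1) by (simp add: p_def coeff_sum)
  then have "p \<noteq> 0" using w(2) by auto
  moreover have "mat_poly_app M p v = 0" for v
  proof -
    have sc: "complex_of_real r *s x = r *\<^sub>R x" for r and x :: "complex^'n"
      by (simp add: complex_vec_eq_iff re_im_vec_smult)
    have lin: "linear (\<lambda>N :: complex^'n^'n. N *v v)"
      by (rule linearI)
        (simp_all add: vec_eq_iff matrix_vector_mult_def scaleR_sum_right distrib_right sum.distrib)
    have "mat_poly_app M p v = (\<Sum>k\<le>D. w k *\<^sub>R (P k *v v))"
      by (simp add: p_def mat_poly_app_sum mat_poly_app_monom P_def sc)
    also have "\<dots> = (\<Sum>k\<le>D. w k *\<^sub>R P k) *v v"
      by (simp add: linear_sum[OF lin] linear_cmul[OF lin])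
    finally show ?thesis by (simp add: w(3))
  qed
  ultimately show thesis by (rule that)
qed

lemma finite_eigenvalues: "finite (eigenvalues M)"
proof -
  obtain p where p: "p \<noteq> 0" "\<And>v. mat_poly_app M p v = 0" using annihilating_poly by blast
  have "eigenvalues M \<subseteq> {\<mu>. poly p \<mu> = 0}"
    using mat_poly_app_eigenvector[of M _ _ p] p(2) by (auto simp: eigenvalues_def)
  then show ?thesis using poly_roots_finite[OF p(1)] by (rule finite_subset)
qed

text \<open>With \<open>W = {0}\<close> this is the existence of eigenvectors; in general it is that of an eigenvector of
  the map induced by \<open>M\<close> on the quotient by \<open>W\<close>.\<close>

lemma eigenvector_modulo:
  fixes W :: "(complex^'n) set"
  assumes scale: "\<And>c x. x \<in> W \<Longrightarrow> c *s x \<in> W" and v: "v \<notin> W" "0 \<in> W"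
  obtains u \<mu> where "u \<notin> W" "M *v u - \<mu> *s u \<in> W"
proof -
  have "\<exists>u \<mu>. u \<notin> W \<and> M *v u - \<mu> *s u \<in> W" if "p \<noteq> 0" "mat_poly_app M p v \<in> W" for p
    using that
  proof (induction "degree p" arbitrary: p rule: less_induct)
    case less
    show ?case
    proof (cases "degree p = 0")
      case True
      then obtain c where c: "p = [:c:]" by (metis degree_eq_zeroE)
      then have "c \<noteq> 0" "c *s v \<in> W" using less.prems by auto
      then have "inverse c *s (c *s v) \<in> W" using scale by blast
      then show ?thesis using v(1) \<open>c \<noteq> 0\<close> by (simp add: vector_smult_assoc)
    next
      case False
      then have "\<not> constant (poly p)" by (simp add: constant_degree)
      then obtain z where "poly p z = 0" using fundamental_theorem_of_algebra by blast
      then obtain q where q: "p = [:-z, 1:] * q" by (auto simp: poly_eq_0_iff_dvd elim: dvdE)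
      have q0: "q \<noteq> 0" using less.prems(1) q by auto
      have "degree q < degree p" using q0 by (simp add: q degree_mult_eq del: mult_pCons_left)
      show ?thesis
      proof (cases "mat_poly_app M q v \<in> W")
        case True
        then show ?thesis using less.hyps[OF \<open>degree q < degree p\<close> q0] by blast
      next
        case False
        moreover have "M *v mat_poly_app M q v - z *s mat_poly_app M q v \<in> W"
          using less.prems(2) by (simp only: q mat_poly_app_linear_factor)
        ultimately show ?thesis by blast
      qed
    qed
  qed
  moreover obtain p where "p \<noteq> 0" "\<And>v. mat_poly_app M p v = 0" using annihilating_poly by blast
  ultimately show thesis using that v(2) by metis
qed

lemma eigenvalues_nonempty: "eigenvalues M \<noteq> {}"
proof -
  have "axis undefined 1 \<notin> {0 :: complex^'n}" by (simp add: axis_eq_0_iff)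
  from eigenvector_modulo[OF _ this, of M] obtain u \<mu> where "u \<noteq> 0" "M *v u - \<mu> *s u = 0" by auto
  then show ?thesis by (auto simp: eigenvalues_def)
qed

lemma stabilizing_iff: "K \<in> stabilizing A B \<longleftrightarrow> (\<forall>\<mu>\<in>eigenvalues (cmat (A + B ** K)). Re \<mu> < 0)"
  by (simp add: stabilizing_def finite_eigenvalues eigenvalues_nonempty)


section \<open>Positivity in the Lyapunov inequality\<close>

lemma complex_matrix_vector_mult_scaleR:
  "(M :: complex^'n^'m) *v (r *\<^sub>R x) = r *\<^sub>R (M *v x)"
  by (rule linear_cmul) simp

text \<open>A maximal \<open>M\<close>-invariant complex subspace \<open>W\<close> on which \<open>Z\<close> is positive definite is the whole space:
  otherwise some \<open>u \<notin> W\<close> satisfies \<open>M u - \<mu> u \<in> W\<close> with an eigenvalue \<open>\<mu>\<close> of \<open>M\<close>; making \<open>u\<close> orthogonal to \<open>W\<close> with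
  respect to \<open>Z\<close> turns the inequality at \<open>u\<close> into \<open>Re \<mu> (u \<bullet> Z u) < 0\<close>, so \<open>Z\<close> is still positive
  definite on the span of \<open>W\<close> and \<open>u\<close>.\<close>

lemma lyapunov_posdef:
  fixes A Z :: "real^'n^'n"
  assumes sym: "transpose Z = Z"
    and diss: "\<And>x. x \<noteq> 0 \<Longrightarrow> x \<bullet> (Z *v (A *v x)) < 0"
    and stable: "\<And>\<mu>. \<mu> \<in> eigenvalues (cmat A) \<Longrightarrow> Re \<mu> < 0"
  shows "posdef Z"
proof -
  define M where "M = cmat A"
  define H where "H = cmat Z"
  have sZ: "(Z *v x) \<bullet> y = x \<bullet> (Z *v y)" for x y by (rule inner_symmetric_matrix[OF sym])
  have sH: "(H *v x) \<bullet> y = x \<bullet> (H *v y)" for x y by (simp add: H_def inner_complex_vec sZ)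
  have iH: "x \<bullet> (H *v (\<i> *s x)) = 0" for x
    using sZ[of "im_vec x" "re_vec x"]
    by (simp add: H_def inner_complex_vec re_im_vec_smult linear_neg[OF matrix_vector_mul_linear] inner_commute)
  have iH2: "x \<bullet> (H *v (\<i> *s y)) = - ((\<i> *s x) \<bullet> (H *v y))" for x y
    by (simp add: H_def inner_complex_vec re_im_vec_smult linear_neg[OF matrix_vector_mul_linear])
  have diss': "x \<bullet> (H *v (M *v x)) < 0" if "x \<noteq> 0" for x
  proof -
    have le: "a \<bullet> (Z *v (A *v a)) \<le> 0" for a using diss[of a] by (cases "a = 0") auto
    have "re_vec x \<noteq> 0 \<or> im_vec x \<noteq> 0" using that by (auto simp: complex_vec_eq_iff)
    then show ?thesis using diss le
      by (auto simp: M_def H_def inner_complex_vec intro: add_neg_nonpos add_nonpos_neg)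
  qed
  define good where "good W \<longleftrightarrow> subspace W \<and> (\<forall>c. \<forall>x\<in>W. c *s x \<in> W) \<and> (\<forall>x\<in>W. M *v x \<in> W) \<and>
    (\<forall>x\<in>W. x \<noteq> 0 \<longrightarrow> 0 < x \<bullet> (H *v x))" for W
  have "good {0}" by (simp add: good_def)
  moreover have "\<forall>W. good W \<longrightarrow> dim W < DIM(complex^'n) + 1"
    using dim_subset_UNIV le_imp_less_Suc by (metis Suc_eq_plus1)
  ultimately obtain W where W: "good W" and max: "\<And>W'. good W' \<Longrightarrow> dim W' \<le> dim W"
    using ex_has_greatest_nat[of good "{0}" dim] by blast
  have subW: "subspace W" and scW: "\<And>c x. x \<in> W \<Longrightarrow> c *s x \<in> W" and MW: "\<And>x. x \<in> W \<Longrightarrow> M *v x \<in> W"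
    and posW: "\<And>x. x \<in> W \<Longrightarrow> x \<noteq> 0 \<Longrightarrow> 0 < x \<bullet> (H *v x)"
    using W by (auto simp: good_def)
  have "W = UNIV"
  proof (rule ccontr)
    assume "W \<noteq> UNIV"
    then obtain v where "v \<notin> W" by auto
    from eigenvector_modulo[OF scW this subspace_0[OF subW], of M]
    obtain u \<mu> where u: "u \<notin> W" "M *v u - \<mu> *s u \<in> W" by blast
    define f where "f x = M *v x - \<mu> *s x" for x
    have linf: "linear f"
      by (rule linearI) (simp_all add: f_def matrix_vector_right_distrib complex_matrix_vector_mult_scaleR
          vec.scale_right_distrib complex_vec_eq_iff re_im_vec_smult algebra_simps)
    have fW: "f ` W \<subseteq> W" using subW scW MW by (auto simp: f_def intro: subspace_diff)
    \<comment> \<open>If \<open>f\<close> is injective on \<open>W\<close>, it maps \<open>W\<close> onto itself and \<open>f u\<close> has a second preimage there.\<close>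
    have "\<exists>x. x \<noteq> 0 \<and> f x = 0"
    proof (cases "inj_on f W")
      case True
      then have "dim (f ` W) = dim W"
        using dim_image_eq[OF linf, of W] subW by (simp add: span_eq_iff[THEN iffD2])
      then have "f ` W = W"
        using subspace_dim_equal[OF linear_subspace_image[OF linf subW] subW fW] by simp
      then obtain w where "w \<in> W" "f w = f u" using u(2) by (auto simp: f_def[of u, symmetric]) (metis imageE)
      then show ?thesis using u(1) by (intro exI[of _ "u - w"]) (auto simp: linear_diff[OF linf])
    next
      case False
      then obtain x y where "x \<noteq> y" "f x = f y" by (auto simp: inj_on_def)
      then show ?thesis by (intro exI[of _ "x - y"]) (auto simp: linear_diff[OF linf])
    qed
    then have "\<mu> \<in> eigenvalues (cmat A)" by (auto simp: eigenvalues_def f_def M_def)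
    then have Re: "Re \<mu> < 0" by (rule stable)
    \<comment> \<open>The complement of \<open>W\<close> with respect to \<open>Z\<close>; it meets \<open>W\<close> trivially, so by dimension the two span everything.\<close>
    define N where "N = {y \<in> UNIV. \<forall>x\<in>(*v) H ` W. orthogonal x y}"
    have N_iff: "y \<in> N \<longleftrightarrow> (\<forall>w\<in>W. w \<bullet> (H *v y) = 0)" for y
      by (simp add: N_def orthogonal_def sH)
    have subN: "subspace N"
      by (auto simp: subspace_def N_iff matrix_vector_right_distrib complex_matrix_vector_mult_scaleR inner_add_right)
    have "subspace ((*v) H ` W)" by (rule linear_subspace_image[OF matrix_vector_mul_linear subW])
    then have "dim N + dim ((*v) H ` W) = dim (UNIV :: (complex^'n) set)"
      unfolding N_def by (intro dim_subspace_orthogonal_to_vectors) auto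
    moreover have "dim ((*v) H ` W) \<le> dim W" by (rule dim_image_le) simp
    moreover have "W \<inter> N = {0}"
      using subspace_0[OF subW] subspace_0[OF subN] posW by (force simp: N_iff)
    ultimately have "dim (UNIV :: (complex^'n) set) \<le> dim {x + y |x y. x \<in> W \<and> y \<in> N}"
      using dim_sums_Int[OF subW subN] by simp
    then have "{x + y |x y. x \<in> W \<and> y \<in> N} = UNIV"
      by (intro subspace_dim_equal[OF subspace_sums[OF subW subN] subspace_UNIV]) auto
    then obtain w0 u1 where wu: "u = w0 + u1" "w0 \<in> W" "u1 \<in> N" by blast
    have u1: "u1 \<notin> W" using u(1) wu subspace_add[OF subW] by blast
    then have "u1 \<noteq> 0" using subspace_0[OF subW] by auto
    have fu1: "f u1 \<in> W"
    proof -
      have "f u1 = f u - f w0" using wu by (simp add: linear_diff[OF linf, symmetric])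
      then show ?thesis using u(2) fW wu(2) subW by (auto simp: f_def[of u] intro: subspace_diff)
    qed
    have Mu1: "M *v u1 = f u1 + Re \<mu> *\<^sub>R u1 + Im \<mu> *\<^sub>R (\<i> *s u1)"
      using smult_conv_scaleR[of \<mu> u1] by (simp add: f_def)
    have "u1 \<bullet> (H *v f u1) = 0"
      using wu(3) fu1 by (simp add: N_iff inner_commute[of u1] sH)
    then have "u1 \<bullet> (H *v (M *v u1)) = Re \<mu> * (u1 \<bullet> (H *v u1))"
      by (simp add: Mu1 matrix_vector_right_distrib complex_matrix_vector_mult_scaleR inner_add_right iH)
    then have "Re \<mu> * (u1 \<bullet> (H *v u1)) < 0" using diss'[OF \<open>u1 \<noteq> 0\<close>] by simp
    then have pu1: "0 < u1 \<bullet> (H *v u1)" using Re by (simp add: mult_less_0_iff)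
    define W' where "W' = {w + c *s u1 |w c. w \<in> W}"
    have W'_I: "w + c *s u1 \<in> W'" if "w \<in> W" for w c using that by (auto simp: W'_def)
    have "good W'"
      unfolding good_def
    proof (intro conjI allI ballI impI)
      show "subspace W'"
        unfolding subspace_def
      proof (intro conjI ballI allI)
        show "0 \<in> W'" using subspace_0[OF subW] by (force simp: W'_def intro: exI[of _ 0])
        show "x + y \<in> W'" if xy: "x \<in> W'" "y \<in> W'" for x y
        proof -
          obtain w c w' c' where wc: "x = w + c *s u1" "w \<in> W" "y = w' + c' *s u1" "w' \<in> W"
            using xy by (auto simp: W'_def)
          then have "x + y = (w + w') + (c + c') *s u1" by (simp add: vec.scale_left_distrib)
          then show ?thesis using W'_I[OF subspace_add[OF subW wc(2,4)]] by (simp only:)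
        qed
        show "r *\<^sub>R x \<in> W'" if x: "x \<in> W'" for r x
        proof -
          obtain w c where wc: "x = w + c *s u1" "w \<in> W" using x by (auto simp: W'_def)
          have "r *\<^sub>R x = r *\<^sub>R w + (of_real r * c) *s u1"
            by (simp add: wc(1) complex_vec_eq_iff re_im_vec_smult algebra_simps)
          then show ?thesis using W'_I[OF subspace_scale[OF subW wc(2)]] by (simp only:)
        qed
      qed
      show "d *s x \<in> W'" if x: "x \<in> W'" for d x
      proof -
        obtain w c where wc: "x = w + c *s u1" "w \<in> W" using x by (auto simp: W'_def)
        then have "d *s x = d *s w + (d * c) *s u1" by (simp add: vec.scale_right_distrib)
        then show ?thesis using W'_I[OF scW[OF wc(2)]] by (simp only:)
      qed
      show "M *v x \<in> W'" if x: "x \<in> W'" for x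
      proof -
        obtain w c where wc: "x = w + c *s u1" "w \<in> W" using x by (auto simp: W'_def)
        have "M *v u1 = f u1 + \<mu> *s u1" by (simp add: f_def)
        then have "M *v x = (M *v w + c *s f u1) + (c * \<mu>) *s u1"
          by (simp add: wc matrix_vector_right_distrib vec.linear_scale[OF matrix_vector_mul_linear_gen] vec.scale_right_distrib)
        then show ?thesis using W'_I[OF subspace_add[OF subW MW[OF wc(2)] scW[OF fu1]]] by (simp only:)
      qed
      show "0 < x \<bullet> (H *v x)" if x: "x \<in> W'" "x \<noteq> 0" for x
      proof -
        obtain w c where wc: "x = w + c *s u1" "w \<in> W" using x by (auto simp: W'_def)
        have "w \<bullet> (H *v u1) = 0" "(\<i> *s w) \<bullet> (H *v u1) = 0" using wu(3) wc(2) scW by (auto simp: N_iff)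
        then have cross: "w \<bullet> (H *v (c *s u1)) = 0"
          by (subst smult_conv_scaleR) (simp add: matrix_vector_right_distrib complex_matrix_vector_mult_scaleR inner_add_right iH2)
        have cc: "(c *s u1) \<bullet> (H *v (c *s u1)) = (Re c * Re c + Im c * Im c) * (u1 \<bullet> (H *v u1))"
          using iH[of u1] iH2[of u1 u1] iH2[of "\<i> *s u1" u1]
          by (subst (1 2) smult_conv_scaleR)
            (simp add: matrix_vector_right_distrib complex_matrix_vector_mult_scaleR inner_add_right inner_add_left algebra_simps)
        have "(c *s u1) \<bullet> (H *v w) = 0" using cross by (metis sH inner_commute)
        then have eq: "x \<bullet> (H *v x) = w \<bullet> (H *v w) + (Re c * Re c + Im c * Im c) * (u1 \<bullet> (H *v u1))"
          by (simp add: wc matrix_vector_right_distrib inner_add_right inner_add_left cross cc)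
        have w0: "0 \<le> w \<bullet> (H *v w)" using posW[OF wc(2)] by (cases "w = 0") auto
        show ?thesis
        proof (cases "c = 0")
          case True
          then show ?thesis using x(2) wc posW[OF wc(2)] by simp
        next
          case False
          then have "0 < Re c * Re c + Im c * Im c"
            by (simp add: complex_eq_iff sum_squares_gt_zero_iff)
          then show ?thesis using eq w0 pu1 by (simp add: add_nonneg_pos)
        qed
      qed
    qed
    moreover have "dim W < dim W'"
    proof (rule dim_psubset)
      have "W \<subseteq> W'" using W'_I[of _ 0] by auto
      moreover have "u1 \<in> W'" using W'_I[OF subspace_0[OF subW], of 1] by simp
      moreover have "subspace W'" using \<open>good W'\<close> by (simp add: good_def)
      ultimately show "span W \<subset> span W'" using u1 subW by (simp add: span_eq_iff[THEN iffD2]) blast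
    qed
    ultimately show False using max by (simp add: leD)
  qed
  have "0 < x \<bullet> (Z *v x)" if "x \<noteq> 0" for x
  proof -
    have "cvec x 0 \<noteq> 0" using that by (simp add: complex_vec_eq_iff)
    then show ?thesis using posW[of "cvec x 0"] \<open>W = UNIV\<close> by (simp add: inner_complex_vec H_def)
  qed
  then show ?thesis using sym by (simp add: posdef_def)
qed


section \<open>Singular values and block matrices\<close>

lemma inner_conj_transpose: "(conj_transpose M *v y) \<bullet> x = y \<bullet> (M *v x)"
proof -
  have cn: "a \<bullet> (c * b) = (cnj c * a) \<bullet> b" for a b c :: complex
    by (simp add: inner_complex_def algebra_simps)
  have "y \<bullet> (M *v x) = (\<Sum>i\<in>UNIV. \<Sum>j\<in>UNIV. (cnj (M $ i $ j) * y $ i) \<bullet> (x $ j))"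
    by (simp add: inner_vec_def matrix_vector_mult_def inner_sum_right cn)
  also have "\<dots> = (conj_transpose M *v y) \<bullet> x"
    by (subst sum.swap) (simp add: inner_vec_def matrix_vector_mult_def inner_sum_left conj_transpose_def transpose_def)
  finally show ?thesis by simp
qed

lemma finite_singular_values: "finite (singular_values M)"
proof (rule finite_subset)
  show "singular_values M \<subseteq> (\<lambda>\<mu>. sqrt (Re \<mu>)) ` eigenvalues (conj_transpose M ** M)"
  proof
    fix \<sigma> assume "\<sigma> \<in> singular_values M"
    then show "\<sigma> \<in> (\<lambda>\<mu>. sqrt (Re \<mu>)) ` eigenvalues (conj_transpose M ** M)"
      by (intro image_eqI[of _ _ "complex_of_real (\<sigma>\<^sup>2)"]) (simp_all add: singular_values_def)
  qed
qed (simp add: finite_eigenvalues)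

text \<open>\<open>sigma_max M\<close> is the operator norm of \<open>M\<close>: the norm of \<open>M b\<close> at a unit vector \<open>b\<close> that maximizes it is a
  singular value.\<close>

lemma
  fixes M :: "complex^'n^'m"
  shows norm_le_sigma_max: "norm (M *v x) \<le> sigma_max M * norm x"
    and sigma_max_le: "(\<And>x. norm (M *v x) \<le> c * norm x) \<Longrightarrow> sigma_max M \<le> c"
proof -
  define f where "f x = (conj_transpose M ** M) *v x" for x
  have f: "f x \<bullet> y = (M *v x) \<bullet> (M *v y)" for x y
    by (simp add: f_def inner_conj_transpose flip: matrix_vector_mul_assoc)
  have fsa: "f x \<bullet> y = x \<bullet> f y" for x y
    by (metis f inner_commute)
  have scal: "complex_of_real r *s v = r *\<^sub>R v" for r and v :: "complex^'n"
    by (simp add: complex_vec_eq_iff re_im_vec_smult)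
  have "linear f" unfolding f_def by simp
  moreover have "UNIV \<noteq> {0 :: complex^'n}"
    using axis_eq_0_iff[of undefined "1 :: complex"] by (metis UNIV_I singletonD zero_neq_one)
  ultimately obtain b where b: "norm b = 1" "f b = (b \<bullet> f b) *\<^sub>R b" "\<And>x. x \<bullet> f x \<le> (b \<bullet> f b) * (x \<bullet> x)"
    using self_adjoint_maximizer[of f UNIV] fsa by (metis UNIV_I subspace_UNIV subset_UNIV)
  have bb: "b \<bullet> f b = (norm (M *v b))\<^sup>2" by (simp add: fsa[symmetric] f dot_square_norm)
  have "f b = complex_of_real ((norm (M *v b))\<^sup>2) *s b" using b(2) by (simp only: bb scal)
  moreover have "b \<noteq> 0" using b(1) by auto
  ultimately have mem: "norm (M *v b) \<in> singular_values M"
    unfolding singular_values_def eigenvalues_def f_def by auto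
  then have "norm (M *v b) \<le> sigma_max M"
    by (simp add: sigma_max_def finite_singular_values)
  moreover have "norm (M *v x) \<le> norm (M *v b) * norm x" for x
  proof (rule power2_le_imp_le)
    show "(norm (M *v x))\<^sup>2 \<le> (norm (M *v b) * norm x)\<^sup>2"
      using b(3)[of x] by (simp add: bb fsa[symmetric] f dot_square_norm power_mult_distrib)
  qed simp
  ultimately show "norm (M *v x) \<le> sigma_max M * norm x"
    by (meson mult_right_mono norm_ge_zero order_trans)
  assume c: "\<And>x. norm (M *v x) \<le> c * norm x"
  have "sigma_max M \<in> singular_values M"
    unfolding sigma_max_def using mem finite_singular_values by (intro Max_in) auto
  then obtain v where v: "v \<noteq> 0" "f v = complex_of_real ((sigma_max M)\<^sup>2) *s v" and s0: "0 \<le> sigma_max M"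
    by (auto simp: singular_values_def eigenvalues_def f_def)
  have "(norm (M *v v))\<^sup>2 = f v \<bullet> v" by (simp add: f dot_square_norm)
  also have "\<dots> = (sigma_max M * norm v)\<^sup>2"
    unfolding v(2) scal by (simp add: dot_square_norm power_mult_distrib)
  finally have "norm (M *v v) = sigma_max M * norm v"
    using s0 by (simp add: power2_eq_iff_nonneg)
  then show "sigma_max M \<le> c" using c[of v] v(1) by simp
qed

text \<open>The concatenation of two vectors, matching the block matrices built by \<open>hcat\<close> and \<open>vcat\<close>.\<close>

definition vjoin :: "'a^'p \<Rightarrow> 'a^'q \<Rightarrow> 'a^('p + 'q)" where
  "vjoin x y = (\<chi> i. case i of Inl p \<Rightarrow> x $ p | Inr q \<Rightarrow> y $ q)"

lemma vjoin_exhaust: obtains x y where "z = vjoin x y"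
proof
  show "z = vjoin (\<chi> p. z $ Inl p) (\<chi> q. z $ Inr q)"
    by (auto simp: vjoin_def vec_eq_iff split: sum.split)
qed

lemma sum_UNIV_Plus:
  fixes f :: "'p::finite + 'q::finite \<Rightarrow> 'a::comm_monoid_add"
  shows "sum f UNIV = (\<Sum>p\<in>UNIV. f (Inl p)) + (\<Sum>q\<in>UNIV. f (Inr q))"
  unfolding UNIV_Plus_UNIV[symmetric] by (subst sum.Plus) auto

lemma hcat_mult_vjoin: "(M ||| N) *v vjoin x y = M *v x + N *v y"
  for M :: "'a::semiring_1^'p^'k"
  by (simp add: vec_eq_iff matrix_vector_mult_def hcat_def vjoin_def sum_UNIV_Plus)

lemma vcat_mult: "(M /// N) *v x = vjoin (M *v x) (N *v x)"
  for M :: "'a::semiring_1^'k^'p"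
  by (auto simp: vec_eq_iff matrix_vector_mult_def vcat_def vjoin_def split: sum.split)

lemma inner_vjoin: "vjoin x y \<bullet> vjoin x' y' = x \<bullet> x' + y \<bullet> y'"
  for x :: "'a::real_inner^'p"
  by (simp add: inner_vec_def vjoin_def sum_UNIV_Plus)

lemma transpose_inner: "(transpose M *v x) \<bullet> y = x \<bullet> (M *v y)" "y \<bullet> (transpose M *v x) = (M *v y) \<bullet> x"
  for M :: "real^'n^'m"
  by (simp_all add: dot_lmul_matrix inner_commute[of y] inner_commute[of _ x])

lemma matrix_vector_mult_uminus: "(- M) *v x = - (M *v x)"
  for M :: "'a::ring_1^'n^'m"
  by (simp add: vec_eq_iff matrix_vector_mult_def sum_negf)

lemma negsemidef_block_iff:
  fixes P :: "real^'n^'n" and D :: "real^'k^'n" and E :: "real^'n^'l" and F :: "real^'n^'m"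
  assumes P: "transpose P = P" "transpose D = D'" "transpose E' = E" "transpose F' = F"
  shows "negsemidef
       (   P  ||| D         ||| E' ||| F'
       /// D' ||| mat (- \<gamma>) ||| 0  ||| 0
       /// E  ||| 0         ||| mat (- \<gamma>) ||| 0
       /// F  ||| 0         ||| 0  ||| mat (- \<gamma>)) \<longleftrightarrow>
    (\<forall>v w y z. v \<bullet> (P *v v) + 2 * (v \<bullet> (D *v w)) + 2 * ((E *v v) \<bullet> y) + 2 * ((F *v v) \<bullet> z)
       \<le> \<gamma> * (w \<bullet> w + y \<bullet> y + z \<bullet> z))"
  (is "negsemidef ?M \<longleftrightarrow> ?R")
proof -
  have mat: "mat c *v x = c *\<^sub>R x" for c and x :: "real^'x"
    by (simp add: vec_eq_iff matrix_vector_mult_def mat_def if_distrib if_distribR cong: if_cong)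
  define j where "j v w y z = vjoin v (vjoin w (vjoin y z))"
    for v :: "real^'n" and w :: "real^'k" and y :: "real^'l" and z :: "real^'m"
  have ex: "\<exists>v w y z. x = j v w y z" for x unfolding j_def by (metis vjoin_exhaust)
  have form: "j v w y z \<bullet> (?M *v j v' w' y' z') = v \<bullet> (P *v v') + v \<bullet> (D *v w') + (E *v v) \<bullet> y' + (F *v v) \<bullet> z'
      + (D *v w) \<bullet> v' + y \<bullet> (E *v v') + z \<bullet> (F *v v') - \<gamma> * (w \<bullet> w' + y \<bullet> y' + z \<bullet> z')"
    for v w y z v' w' y' z'
    unfolding j_def P(2-4)[symmetric]
    by (simp only: vcat_mult hcat_mult_vjoin inner_vjoin transpose_inner mat inner_add_right inner_add_left
       matrix_vector_mult_0 inner_zero_right)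
      (simp add: algebra_simps transpose_inner)
  have symP: "(P *v x) \<bullet> y = x \<bullet> (P *v y)" for x y by (rule inner_symmetric_matrix[OF P(1)])
  have sym: "transpose ?M = ?M"
  proof (rule symmetric_matrixI)
    fix a b
    obtain v w y z v' w' y' z' where ab: "a = j v w y z" "b = j v' w' y' z'" using ex by metis
    have "b \<bullet> (?M *v a) = a \<bullet> (?M *v b)"
      using symP[of v v'] unfolding ab form by (simp add: inner_commute)
    then show "(?M *v a) \<bullet> b = a \<bullet> (?M *v b)" by (simp only: inner_commute)
  qed
  have "transpose (- ?M) = - ?M" using sym by (simp add: transpose_def vec_eq_iff)
  then have "negsemidef ?M \<longleftrightarrow> (\<forall>x. x \<bullet> (?M *v x) \<le> 0)"
    by (simp add: negsemidef_def possemidef_def matrix_vector_mult_uminus)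
  also have "\<dots> \<longleftrightarrow> (\<forall>v w y z. j v w y z \<bullet> (?M *v j v w y z) \<le> 0)" using ex by metis
  also have "\<dots> \<longleftrightarrow> ?R" by (simp add: form inner_commute algebra_simps)
  finally show ?thesis .
qed


section \<open>The closed loop\<close>

text \<open>The data of the control problem. As \<open>B\<^sub>w\<close> is square, full row rank means invertibility.\<close>

locale hinf_problem =
  fixes A B\<^sub>w Q :: "real^'n^'n" and B :: "real^'m^'n" and R :: "real^'m^'m"
  assumes rank_Bw: "rank B\<^sub>w = CARD('n)" and posdef_Q: "posdef Q" and posdef_R: "posdef R"
begin

definition closed_loop :: "real^'n^'m \<Rightarrow> real^'n^'n" where
  "closed_loop K = A + B ** K"

text \<open>The map \<open>i \<omega> - A - B K\<close> (the inverse of the resolvent) on the imaginary axis.\<close>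

definition res :: "real^'n^'m \<Rightarrow> real \<Rightarrow> complex^'n \<Rightarrow> complex^'n" where
  "res K \<omega> x = (\<i> * complex_of_real \<omega>) *s x - cmat (closed_loop K) *v x"

text \<open>The output matrix \<open>[Q\<^sup>1\<^sup>/\<^sup>2; R\<^sup>1\<^sup>/\<^sup>2 K]\<close>.\<close>

definition out :: "real^'n^'m \<Rightarrow> complex^'n^('n + 'm)" where
  "out K = cmat (msqrt Q /// msqrt R ** K)"

abbreviation T :: "real^'n^'m \<Rightarrow> real \<Rightarrow> complex^'n^('n + 'm)" where
  "T K \<omega> \<equiv> T_zw A B B\<^sub>w Q R K (\<i> * complex_of_real \<omega>)"

abbreviation J :: "real^'n^'m \<Rightarrow> real" where
  "J K \<equiv> J_inf A B B\<^sub>w Q R K"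

text \<open>A lower bound for \<open>i \<omega> - A - B K\<close> that is uniform in the frequency. All estimates of the cost only need this,
  rather than stability.\<close>

definition gap :: "real \<Rightarrow> real^'n^'m \<Rightarrow> bool" where
  "gap c K \<longleftrightarrow> 0 < c \<and> (\<forall>\<omega> x. c * norm x \<le> norm (res K \<omega> x))"

lemma gapD: "gap c K \<Longrightarrow> 0 < c" "gap c K \<Longrightarrow> c * norm x \<le> norm (res K \<omega> x)"
  by (simp_all add: gap_def)

lemma linear_res: "linear (res K \<omega>)"
  by (rule linearI) (simp_all add: res_def complex_vec_eq_iff re_im_vec_smult algebra_simps matrix_vector_right_distrib)

lemma re_im_res:
  "re_vec (res K \<omega> x) = - (\<omega> *\<^sub>R im_vec x) - closed_loop K *v re_vec x"
  "im_vec (res K \<omega> x) = \<omega> *\<^sub>R re_vec x - closed_loop K *v im_vec x"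
  by (simp_all add: res_def re_im_vec_smult)

lemma res_matrix:
  "(mat (\<i> * complex_of_real \<omega>) - cmat A - cmat (B ** K)) *v x = res K \<omega> x"
proof -
  have "mat s *v x = s *s x" for s
    by (simp add: vec_eq_iff matrix_vector_mult_def mat_def if_distrib if_distribR cong: if_cong)
  moreover have "cmat (closed_loop K) = cmat A + cmat (B ** K)" by (simp add: closed_loop_def vec_eq_iff)
  ultimately show ?thesis
    by (simp add: res_def matrix_vector_mult_diff_rdistrib matrix_vector_mult_add_rdistrib)
qed

lemma
  assumes "gap c K"
  shows res_surj: "\<exists>x. res K \<omega> x = y"
    and T_apply: "res K \<omega> x = cmat B\<^sub>w *v w \<Longrightarrow> T K \<omega> *v w = out K *v x"
proof -
  define M where "M = mat (\<i> * complex_of_real \<omega>) - cmat A - cmat (B ** K)"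
  have Mx: "M *v x = res K \<omega> x" for x by (simp add: M_def res_matrix)
  have "x = 0" if "M *v x = 0" for x
    using gapD(1)[OF assms] gapD(2)[OF assms, of x \<omega>] that by (simp add: Mx mult_le_0_iff)
  then have "invertible M"
    by (auto simp: invertible_left_inverse matrix_left_invertible_ker)
  then have inv: "M ** matrix_inv M = mat 1 \<and> matrix_inv M ** M = mat 1"
    unfolding invertible_def matrix_inv_def by (rule someI_ex)
  then show "\<exists>x. res K \<omega> x = y"
    by (intro exI[of _ "matrix_inv M *v y"]) (simp add: matrix_vector_mul_assoc flip: Mx)
  assume "res K \<omega> x = cmat B\<^sub>w *v w"
  then have "matrix_inv M *v (cmat B\<^sub>w *v w) = x"
    using inv by (metis Mx matrix_vector_mul_assoc matrix_vector_mul_lid)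
  then show "T K \<omega> *v w = out K *v x"
    by (simp add: T_zw_def M_def[symmetric] out_def matrix_vector_mul_assoc[symmetric])
qed

lemma norm_out: "(norm (out K *v x))\<^sup>2 = (norm (msqrt Q *v re_vec x))\<^sup>2 + (norm (msqrt Q *v im_vec x))\<^sup>2
    + (norm (msqrt R *v (K *v re_vec x)))\<^sup>2 + (norm (msqrt R *v (K *v im_vec x)))\<^sup>2"
  by (simp add: out_def norm_complex_vec vcat_mult inner_vjoin matrix_vector_mul_assoc flip: dot_square_norm)

lemma gap_stabilizing:
  assumes "K \<in> stabilizing A B"
  obtains c where "gap c K"
proof -
  define M where "M = cmat (closed_loop K)"
  obtain a where a: "0 < a" "\<And>x. norm (M *v x) \<le> a * norm x"
    using linear_bounded_pos[of "(*v) M"] by auto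
  \<comment> \<open>Frequencies beyond \<open>a + 1\<close> dominate \<open>A + B K\<close>; for the others a compactness argument applies.\<close>
  define S where "S = {- (a + 1)..a + 1} \<times> sphere (0 :: complex^'n) 1"
  have nz: "res K \<omega> x \<noteq> 0" if "x \<noteq> 0" for \<omega> x
  proof
    assume "res K \<omega> x = 0"
    then have "\<i> * complex_of_real \<omega> \<in> eigenvalues (cmat (A + B ** K))"
      using that by (auto simp: eigenvalues_def res_def closed_loop_def intro!: exI[of _ x])
    then show False using assms by (auto simp: stabilizing_iff)
  qed
  have res_eq: "res K \<omega> x = \<omega> *\<^sub>R (\<i> *s x) - M *v x" for \<omega> x
    by (simp add: res_def M_def complex_vec_eq_iff re_im_vec_smult)
  have lin: "linear (\<lambda>x. \<i> *s (x :: complex^'n))"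
    by (rule linearI) (simp_all add: complex_vec_eq_iff re_im_vec_smult)
  have cont: "continuous_on S (\<lambda>p. norm (res K (fst p) (snd p)))"
    unfolding res_eq
    by (intro continuous_intros linear_continuous_on_compose[OF _ lin] linear_continuous_on_compose[OF _ matrix_vector_mul_linear])
  have "compact S" unfolding S_def by (intro compact_Times) auto
  moreover have "S \<noteq> {}"
    using a(1) vector_choose_size[of 1] by (auto simp: S_def)
  ultimately obtain p where p: "p \<in> S" "\<And>q. q \<in> S \<Longrightarrow> norm (res K (fst p) (snd p)) \<le> norm (res K (fst q) (snd q))"
    using continuous_attains_inf[OF _ _ cont] by auto
  define c where "c = norm (res K (fst p) (snd p))"
  have "norm (snd p) = 1" using p(1) by (auto simp: S_def)
  then have "snd p \<noteq> 0" by auto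
  then have c: "0 < c" using nz by (simp add: c_def)
  have "min c 1 * norm x \<le> norm (res K \<omega> x)" for \<omega> x
  proof (cases "\<bar>\<omega>\<bar> \<le> a + 1")
    case True
    show ?thesis
    proof (cases "x = 0")
      case False
      then have "(\<omega>, x /\<^sub>R norm x) \<in> S" using True by (auto simp: S_def)
      from p(2)[OF this] have "c \<le> norm (res K \<omega> x) / norm x"
        by (simp add: c_def linear_cmul[OF linear_res] divide_inverse mult.commute)
      then have "c * norm x \<le> norm (res K \<omega> x)" using False by (simp add: field_simps)
      then show ?thesis by (meson min.cobounded1 mult_right_mono norm_ge_zero order_trans)
    qed simp
  next
    case False
    have "(norm (\<i> *s x))\<^sup>2 = (norm x)\<^sup>2" by (simp add: norm_complex_vec re_im_vec_smult)
    then have "norm (\<i> *s x) = norm x" by (simp add: power2_eq_iff_nonneg)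
    then have "\<bar>\<omega>\<bar> * norm x - a * norm x \<le> norm (res K \<omega> x)"
      using norm_triangle_ineq2[of "\<omega> *\<^sub>R (\<i> *s x)" "M *v x"] a(2)[of x] by (simp add: res_eq)
    moreover have "1 * norm x \<le> (\<bar>\<omega>\<bar> - a) * norm x" using False by (intro mult_right_mono) auto
    moreover have "min c 1 * norm x \<le> 1 * norm x" by (intro mult_right_mono) auto
    ultimately show ?thesis by (simp add: algebra_simps)
  qed
  then have "gap (min c 1) K" using c by (simp add: gap_def)
  then show thesis by (rule that)
qed

lemma T_bounded:
  assumes "gap c K"
  obtains b where "\<And>\<omega>. sigma_max (T K \<omega>) \<le> b"
proof -
  obtain a where a: "0 < a" "\<And>x. norm (out K *v x) \<le> a * norm x"
    using linear_bounded_pos[of "(*v) (out K)"] by auto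
  obtain d where d: "0 < d" "\<And>w. norm (cmat B\<^sub>w *v w) \<le> d * norm w"
    using linear_bounded_pos[of "(*v) (cmat B\<^sub>w)"] by auto
  have "sigma_max (T K \<omega>) \<le> a * (d / c)" for \<omega>
  proof (rule sigma_max_le)
    fix w
    obtain x where x: "res K \<omega> x = cmat B\<^sub>w *v w" using res_surj[OF assms] by blast
    have "c * norm x \<le> d * norm w" using gapD(2)[OF assms, of x \<omega>] d(2)[of w] x by simp
    then have "norm x \<le> d / c * norm w" using gapD(1)[OF assms] by (simp add: field_simps)
    then have "a * norm x \<le> a * (d / c * norm w)" using a(1) by (intro mult_left_mono) auto
    then show "norm (T K \<omega> *v w) \<le> a * (d / c) * norm w"
      using a(2)[of x] T_apply[OF assms x] by simp
  qed
  then show thesis by (rule that)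
qed

lemma T_le_J:
  assumes "gap c K"
  shows "norm (T K \<omega> *v w) \<le> J K * norm w"
proof -
  obtain b where "\<And>\<omega>. sigma_max (T K \<omega>) \<le> b" using T_bounded[OF assms] by blast
  then have "bdd_above (range (\<lambda>\<omega>. sigma_max (T K \<omega>)))" by (rule bdd_aboveI2)
  then have "sigma_max (T K \<omega>) \<le> J K" unfolding J_inf_def hinf_norm_def by (rule cSUP_upper[rotated]) simp
  then show ?thesis using norm_le_sigma_max[of "T K \<omega>" w] by (meson mult_right_mono norm_ge_zero order_trans)
qed

lemma J_le:
  assumes "\<And>\<omega> w. norm (T K \<omega> *v w) \<le> g * norm w"
  shows "J K \<le> g"
  unfolding J_inf_def hinf_norm_def by (rule cSUP_least) (auto intro: sigma_max_le assms)

end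


section \<open>The matrix inequality and the cost\<close>

lemma scaleR_matrix_vector: "(k *\<^sub>R M) *v x = k *\<^sub>R (M *v x)" for M :: "real^'n^'m"
  by (simp add: scaleR_matrix_vector_assoc)

lemma inner_scaled_le: "2 * g * (a \<bullet> b) \<le> a \<bullet> a + g\<^sup>2 * (b \<bullet> b)"
proof -
  have "(a - g *\<^sub>R b) \<bullet> (a - g *\<^sub>R b) = a \<bullet> a + g\<^sup>2 * (b \<bullet> b) - 2 * g * (a \<bullet> b)"
    by (simp add: inner_diff_left inner_diff_right inner_commute[of b a] power2_eq_square) (simp add: algebra_simps)
  then show ?thesis using inner_ge_zero[of "a - g *\<^sub>R b"] by linarith
qed

lemma transpose_plus: "transpose (M + N) = transpose M + transpose N"
  by (simp add: transpose_def vec_eq_iff)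

lemma posdef_convex_comb:
  fixes X X' :: "real^'n^'n"
  assumes "posdef X" "posdef X'" "0 \<le> s" "0 \<le> t" "s + t = 1"
  shows "posdef (s *\<^sub>R X + t *\<^sub>R X')"
proof -
  have "0 < x \<bullet> ((s *\<^sub>R X + t *\<^sub>R X') *v x)" if "x \<noteq> 0" for x
  proof -
    have "0 < x \<bullet> (X *v x)" "0 < x \<bullet> (X' *v x)" using assms that by (auto simp: posdef_def)
    moreover have "0 < s \<or> 0 < t" using assms by linarith
    ultimately have "0 < s * (x \<bullet> (X *v x)) + t * (x \<bullet> (X' *v x))"
      using assms by (auto intro: add_pos_nonneg add_nonneg_pos)
    then show ?thesis
      by (simp add: matrix_vector_mult_add_rdistrib scaleR_matrix_vector inner_add_right)
  qed
  then show ?thesis using assms(1,2) by (simp add: posdef_def transpose_plus transpose_scalar)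
qed

context hinf_problem
begin

lemma psd_Q: "possemidef Q" and psd_R: "possemidef R"
  using posdef_Q posdef_R by (auto intro: posdef_imp_possemidef)

lemma F_iff: "(\<gamma>, Y, X) \<in> F_inf A B B\<^sub>w Q R \<longleftrightarrow> posdef X \<and>
   (\<forall>v w y z. 2 * (v \<bullet> (A *v (X *v v) + B *v (Y *v v))) + 2 * (v \<bullet> (B\<^sub>w *v w))
      + 2 * ((msqrt Q *v (X *v v)) \<bullet> y) + 2 * ((msqrt R *v (Y *v v)) \<bullet> z)
      \<le> \<gamma> * (w \<bullet> w + y \<bullet> y + z \<bullet> z))"
proof (cases "posdef X")
  case True
  then have X: "transpose X = X" by (simp add: posdef_def)
  define P where "P = A ** X + B ** Y + X ** transpose A + transpose Y ** transpose B"
  have P: "transpose P = P"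
    by (simp add: P_def transpose_plus matrix_transpose_mul X add_ac)
  have sX: "(X *v a) \<bullet> b = a \<bullet> (X *v b)" for a b by (rule inner_symmetric_matrix[OF X])
  have "v \<bullet> (P *v v) = 2 * (v \<bullet> (A *v (X *v v) + B *v (Y *v v)))" for v
  proof -
    have "v \<bullet> ((X ** transpose A) *v v) = (X *v v) \<bullet> (transpose A *v v)"
      by (simp only: sX matrix_vector_mul_assoc)
    moreover have "v \<bullet> ((transpose Y ** transpose B) *v v) = (Y *v v) \<bullet> (transpose B *v v)"
      by (simp only: transpose_inner flip: matrix_vector_mul_assoc)
    ultimately show ?thesis
      by (simp only: P_def matrix_vector_mult_add_rdistrib inner_add_right transpose_inner flip: matrix_vector_mul_assoc)
        (simp add: inner_commute)
  qed
  moreover have "transpose (X ** msqrt Q) = msqrt Q ** X" "transpose (transpose Y ** msqrt R) = msqrt R ** Y"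
    using psd_Q psd_R by (simp_all add: matrix_transpose_mul X transpose_msqrt)
  ultimately show ?thesis
    using True unfolding F_inf_def mem_Collect_eq prod.case P_def[symmetric]
    by (subst negsemidef_block_iff[OF P refl]) (simp_all add: matrix_vector_mul_assoc)
qed (simp add: F_inf_def)

lemma convex_F: "convex (F_inf A B B\<^sub>w Q R)"
proof (rule convexI)
  fix p q s t
  assume pq: "p \<in> F_inf A B B\<^sub>w Q R" "q \<in> F_inf A B B\<^sub>w Q R" and st: "0 \<le> (s::real)" "0 \<le> t" "s + t = 1"
  obtain \<gamma> Y X \<gamma>' Y' X' where pq': "p = (\<gamma>, Y, X)" "q = (\<gamma>', Y', X')" by (metis prod.exhaust)
  note F = pq[unfolded pq' F_iff]
  have "posdef (s *\<^sub>R X + t *\<^sub>R X')" using F st by (auto intro: posdef_convex_comb)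
  moreover have "2 * (v \<bullet> (A *v ((s *\<^sub>R X + t *\<^sub>R X') *v v) + B *v ((s *\<^sub>R Y + t *\<^sub>R Y') *v v))) + 2 * (v \<bullet> (B\<^sub>w *v w))
      + 2 * ((msqrt Q *v ((s *\<^sub>R X + t *\<^sub>R X') *v v)) \<bullet> y) + 2 * ((msqrt R *v ((s *\<^sub>R Y + t *\<^sub>R Y') *v v)) \<bullet> z)
      \<le> (s * \<gamma> + t * \<gamma>') * (w \<bullet> w + y \<bullet> y + z \<bullet> z)" for v w y z
  proof -
    define b where "b = 2 * (v \<bullet> (B\<^sub>w *v w))"
    define n where "n = w \<bullet> w + y \<bullet> y + z \<bullet> z"
    define l where "l X Y = 2 * (v \<bullet> (A *v (X *v v) + B *v (Y *v v)))
      + 2 * ((msqrt Q *v (X *v v)) \<bullet> y) + 2 * ((msqrt R *v (Y *v v)) \<bullet> z)" for X Y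
    have "l X Y + b \<le> \<gamma> * n" "l X' Y' + b \<le> \<gamma>' * n"
      using F unfolding l_def b_def n_def by (auto simp: algebra_simps)
    then have "s * (l X Y + b) + t * (l X' Y' + b) \<le> s * (\<gamma> * n) + t * (\<gamma>' * n)"
      using st by (intro add_mono mult_left_mono)
    moreover have "s * b + t * b = b" using st(3) by (metis distrib_right mult_1)
    moreover have "l (s *\<^sub>R X + t *\<^sub>R X') (s *\<^sub>R Y + t *\<^sub>R Y') = s * l X Y + t * l X' Y'"
      by (simp add: l_def matrix_vector_mult_add_rdistrib scaleR_matrix_vector matrix_vector_right_distrib
          matrix_vector_mult_scaleR inner_add_left inner_add_right algebra_simps)
    ultimately have "l (s *\<^sub>R X + t *\<^sub>R X') (s *\<^sub>R Y + t *\<^sub>R Y') + b \<le> (s * \<gamma> + t * \<gamma>') * n"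
      by (simp add: algebra_simps)
    then show ?thesis by (simp add: l_def b_def n_def)
  qed
  ultimately show "s *\<^sub>R p + t *\<^sub>R q \<in> F_inf A B B\<^sub>w Q R"
    by (simp add: pq' F_iff)
qed

lemma Bw_inverse: obtains N where "N ** B\<^sub>w = mat 1" "B\<^sub>w ** N = mat 1"
proof -
  have "inj ((*v) B\<^sub>w)" using rank_Bw by (simp add: full_rank_injective)
  then obtain N where "N ** B\<^sub>w = mat 1" using matrix_left_invertible_injective by metis
  then show thesis using that matrix_left_right_inverse by blast
qed

lemma F_gain_iff: "(\<gamma>, K ** X, X) \<in> F_inf A B B\<^sub>w Q R \<longleftrightarrow> posdef X \<and>
   (\<forall>v w y z. 2 * (v \<bullet> (closed_loop K *v (X *v v))) + 2 * (v \<bullet> (B\<^sub>w *v w))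
      + 2 * ((msqrt Q *v (X *v v)) \<bullet> y) + 2 * ((msqrt R *v (K *v (X *v v))) \<bullet> z)
      \<le> \<gamma> * (w \<bullet> w + y \<bullet> y + z \<bullet> z))"
  by (simp add: F_iff closed_loop_def matrix_vector_mult_add_rdistrib flip: matrix_vector_mul_assoc)

text \<open>The second conclusion inserts the optimal values of \<open>y\<close> and \<open>z\<close> into the inequality, and the third one inserts
  \<open>y = 0\<close>, \<open>z = 0\<close> and the optimal value \<open>B\<^sub>w\<^sup>T v / \<gamma>\<close> of \<open>w\<close>, which is nonzero because \<open>B\<^sub>w\<close> is invertible.\<close>

lemma F_gain_bounds:
  assumes F: "(\<gamma>, K ** X, X) \<in> F_inf A B B\<^sub>w Q R"
  shows F_pos: "0 < \<gamma>"
    and F_output: "2 * (v \<bullet> (closed_loop K *v (X *v v))) + 2 * (v \<bullet> (B\<^sub>w *v w))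
      + ((norm (msqrt Q *v (X *v v)))\<^sup>2 + (norm (msqrt R *v (K *v (X *v v))))\<^sup>2) / \<gamma> \<le> \<gamma> * (norm w)\<^sup>2"
    and F_dissipation: "v \<noteq> 0 \<Longrightarrow> v \<bullet> (closed_loop K *v (X *v v)) < 0"
proof -
  note form = F[unfolded F_gain_iff, THEN conjunct2, rule_format]
  obtain N where N: "N ** B\<^sub>w = mat 1" "B\<^sub>w ** N = mat 1" by (rule Bw_inverse)
  have BN: "B\<^sub>w *v (N *v a) = a" for a by (simp add: matrix_vector_mul_assoc N)
  have nz: "axis undefined 1 \<noteq> (0 :: real^'n)" by (simp add: axis_eq_0_iff)
  have "0 \<le> \<gamma> * ((axis undefined 1 :: real^'n) \<bullet> axis undefined 1)"
    using form[of 0 "axis undefined 1" 0 0] by simp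
  then have "0 \<le> \<gamma>" using nz by (simp add: zero_le_mult_iff)
  moreover have "\<gamma> \<noteq> 0"
  proof
    assume "\<gamma> = 0"
    define v :: "real^'n" where "v = axis undefined 1"
    define a where "a = v \<bullet> (closed_loop K *v (X *v v))"
    have "2 * a + 2 * (t * (v \<bullet> v)) \<le> 0" for t
      using form[of v "N *v (t *\<^sub>R v)" 0 0] \<open>\<gamma> = 0\<close> by (simp add: BN a_def)
    moreover have "0 < v \<bullet> v" using nz by (simp add: v_def)
    ultimately have "2 * a + 2 * ((1 - a) / (v \<bullet> v) * (v \<bullet> v)) \<le> 0" by blast
    then show False using \<open>0 < v \<bullet> v\<close> by simp
  qed
  ultimately show pos: "0 < \<gamma>" by simp
  show out: "2 * (v \<bullet> (closed_loop K *v (X *v v))) + 2 * (v \<bullet> (B\<^sub>w *v w))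
      + ((norm (msqrt Q *v (X *v v)))\<^sup>2 + (norm (msqrt R *v (K *v (X *v v))))\<^sup>2) / \<gamma> \<le> \<gamma> * (norm w)\<^sup>2" for v w
  proof -
    define a where "a = msqrt Q *v (X *v v)"
    define b where "b = msqrt R *v (K *v (X *v v))"
    have sq: "\<gamma> * (((1 / \<gamma>) *\<^sub>R a) \<bullet> ((1 / \<gamma>) *\<^sub>R a)) = (a \<bullet> a) / \<gamma>"
      "\<gamma> * (((1 / \<gamma>) *\<^sub>R b) \<bullet> ((1 / \<gamma>) *\<^sub>R b)) = (b \<bullet> b) / \<gamma>"
      "a \<bullet> ((1 / \<gamma>) *\<^sub>R a) = (a \<bullet> a) / \<gamma>" "b \<bullet> ((1 / \<gamma>) *\<^sub>R b) = (b \<bullet> b) / \<gamma>"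
      using pos by (simp_all add: field_simps)
    show ?thesis
      using form[of v w "(1 / \<gamma>) *\<^sub>R a" "(1 / \<gamma>) *\<^sub>R b"]
      unfolding a_def[symmetric] b_def[symmetric] dot_square_norm[symmetric]
      unfolding distrib_left[of \<gamma>] add_divide_distrib sq by linarith
  qed
  assume "v \<noteq> 0"
  define w where "w = transpose B\<^sub>w *v v"
  have "w \<noteq> 0"
  proof
    assume "w = 0"
    then have "v \<bullet> (B\<^sub>w *v (N *v v)) = 0" using transpose_inner(1)[of "B\<^sub>w" v "N *v v"] by (simp add: w_def)
    then show False using \<open>v \<noteq> 0\<close> by (simp add: BN)
  qed
  have "v \<bullet> (B\<^sub>w *v ((1 / \<gamma>) *\<^sub>R w)) = (w \<bullet> w) / \<gamma>"
    using transpose_inner(1)[of "B\<^sub>w" v w] by (simp add: w_def matrix_vector_mult_scaleR)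
  then have "2 * (v \<bullet> (closed_loop K *v (X *v v))) + (w \<bullet> w) / \<gamma> \<le> 0"
    using form[of v "(1 / \<gamma>) *\<^sub>R w" 0 0] pos by (simp add: field_simps)
  moreover have "0 < (w \<bullet> w) / \<gamma>" using pos \<open>w \<noteq> 0\<close> by simp
  ultimately show "v \<bullet> (closed_loop K *v (X *v v)) < 0" by linarith
qed

text \<open>Along an eigenvector, or along a pair \<open>(x, w)\<close> with \<open>i \<omega> x = (A + B K) x + B\<^sub>w w\<close>, the inequality is evaluated at
  the real and imaginary parts of \<open>X\<^sup>-\<^sup>1 x\<close>, and the skew contributions of \<open>\<omega>\<close> cancel in the sum.\<close>

lemma F_imp_cost_le:
  assumes F: "(\<gamma>, K ** X, X) \<in> F_inf A B B\<^sub>w Q R"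
  shows "K \<in> stabilizing A B" "J K \<le> \<gamma>"
proof -
  have pX: "posdef X" using F by (simp add: F_gain_iff)
  then have sX: "(X *v a) \<bullet> b = a \<bullet> (X *v b)" for a b
    by (intro inner_symmetric_matrix) (simp add: posdef_def)
  obtain N where "X ** N = mat 1" using posdef_invertible[OF pX] by (auto simp: invertible_def)
  then have XN: "X *v (N *v a) = a" for a by (simp add: matrix_vector_mul_assoc)
  have \<gamma>: "0 < \<gamma>" by (rule F_pos[OF F])
  show stab: "K \<in> stabilizing A B"
    unfolding stabilizing_iff closed_loop_def[symmetric]
  proof
    fix \<mu> assume "\<mu> \<in> eigenvalues (cmat (closed_loop K))"
    then obtain x where x: "x \<noteq> 0" "cmat (closed_loop K) *v x = \<mu> *s x" by (auto simp: eigenvalues_def)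
    define v1 v2 where "v1 = N *v re_vec x" and "v2 = N *v im_vec x"
    have x12: "re_vec x = X *v v1" "im_vec x = X *v v2" by (simp_all add: v1_def v2_def XN)
    have e1: "closed_loop K *v (X *v v1) = Re \<mu> *\<^sub>R (X *v v1) - Im \<mu> *\<^sub>R (X *v v2)"
      and e2: "closed_loop K *v (X *v v2) = Re \<mu> *\<^sub>R (X *v v2) + Im \<mu> *\<^sub>R (X *v v1)"
      using x(2) by (simp_all add: complex_vec_eq_iff re_im_vec_smult x12)
    have le: "v \<bullet> (closed_loop K *v (X *v v)) \<le> 0" "0 \<le> v \<bullet> (X *v v)" for v
      using F_dissipation[OF F, of v] posdef_imp_possemidef[OF pX]
      by (cases "v = 0", simp_all add: possemidef_def)
    have "v1 \<noteq> 0 \<or> v2 \<noteq> 0" using x(1) x12 by (auto simp: complex_vec_eq_iff)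
    then have "v1 \<bullet> (closed_loop K *v (X *v v1)) + v2 \<bullet> (closed_loop K *v (X *v v2)) < 0"
      using F_dissipation[OF F] le(1) by (auto intro: add_neg_nonpos add_nonpos_neg)
    then have "Re \<mu> * (v1 \<bullet> (X *v v1) + v2 \<bullet> (X *v v2)) < 0"
      using sX[of v1 v2] by (simp add: e1 e2 inner_diff_right inner_add_right inner_commute[of "X *v v1"] algebra_simps)
    then show "Re \<mu> < 0" using le(2)[of v1] le(2)[of v2] by (smt (verit) mult_nonneg_nonneg)
  qed
  obtain c where c: "gap c K" using gap_stabilizing[OF stab] .
  show "J K \<le> \<gamma>"
  proof (rule J_le)
    fix \<omega> w
    obtain x where x: "res K \<omega> x = cmat B\<^sub>w *v w" using res_surj[OF c] by blast
    define v1 v2 where "v1 = N *v re_vec x" and "v2 = N *v im_vec x"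
    have x12: "re_vec x = X *v v1" "im_vec x = X *v v2" by (simp_all add: v1_def v2_def XN)
    have e1: "B\<^sub>w *v re_vec w = - (\<omega> *\<^sub>R (X *v v2)) - closed_loop K *v (X *v v1)"
      and e2: "B\<^sub>w *v im_vec w = \<omega> *\<^sub>R (X *v v1) - closed_loop K *v (X *v v2)"
      using x by (simp_all add: complex_vec_eq_iff re_im_res x12)
    define q where "q v = (norm (msqrt Q *v (X *v v)))\<^sup>2 + (norm (msqrt R *v (K *v (X *v v))))\<^sup>2" for v
    have "- 2 * \<omega> * (v1 \<bullet> (X *v v2)) + q v1 / \<gamma> \<le> \<gamma> * (norm (re_vec w))\<^sup>2"
      using F_output[OF F, of v1 "re_vec w"] by (simp add: e1 q_def inner_diff_right)
    moreover have "2 * \<omega> * (v2 \<bullet> (X *v v1)) + q v2 / \<gamma> \<le> \<gamma> * (norm (im_vec w))\<^sup>2"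
      using F_output[OF F, of v2 "im_vec w"] by (simp add: e2 q_def inner_diff_right)
    moreover have "v2 \<bullet> (X *v v1) = v1 \<bullet> (X *v v2)" using sX[of v1 v2] by (simp add: inner_commute)
    ultimately have "(q v1 + q v2) / \<gamma> \<le> \<gamma> * (norm w)\<^sup>2"
      by (simp add: norm_complex_vec[of w] distrib_left add_divide_distrib)
    then have "q v1 + q v2 \<le> (\<gamma> * norm w)\<^sup>2" using \<gamma> by (simp add: field_simps power2_eq_square)
    moreover have "q v1 + q v2 = (norm (T K \<omega> *v w))\<^sup>2"
      by (simp add: T_apply[OF c x] norm_out x12 q_def)
    ultimately have "(norm (T K \<omega> *v w))\<^sup>2 \<le> (\<gamma> * norm w)\<^sup>2" by linarith
    then show "norm (T K \<omega> *v w) \<le> \<gamma> * norm w"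
      by (rule power2_le_imp_le) (simp add: less_imp_le[OF \<gamma>])
  qed
qed

lemma J_pos:
  assumes "gap c K"
  shows "0 < J K"
proof (rule ccontr)
  assume J: "\<not> 0 < J K"
  obtain N where N: "N ** B\<^sub>w = mat 1" "B\<^sub>w ** N = mat 1" by (rule Bw_inverse)
  have BN: "B\<^sub>w *v (N *v a) = a" for a by (simp add: matrix_vector_mul_assoc N)
  define x :: "complex^'n" where "x = cvec (axis undefined 1) 0"
  define w where "w = cmat N *v res K 0 x"
  have x: "res K 0 x = cmat B\<^sub>w *v w"
    by (simp add: w_def complex_vec_eq_iff BN)
  have "norm (out K *v x) \<le> J K * norm w" using T_le_J[OF assms, of 0 w] by (simp only: T_apply[OF assms x])
  then have "norm (out K *v x) \<le> 0" using J by (smt (verit) mult_nonpos_nonneg norm_ge_zero)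
  then have "(norm (out K *v x))\<^sup>2 = 0" by simp
  then have "(norm (msqrt Q *v re_vec x))\<^sup>2 = 0"
    unfolding norm_out by (smt (verit) zero_le_power2)
  then have "re_vec x = 0" by (simp add: msqrt_eq_0_iff[OF posdef_Q])
  then show False by (simp add: x_def axis_eq_0_iff)
qed

text \<open>The frequency condition of \<open>kyp\<close> for \<open>\<beta> (x, y) (x, y) = g\<^sup>2 |B\<^sub>w\<^sup>-\<^sup>1 (y - A\<^sub>K x)|\<^sup>2 - |Q\<^sup>1\<^sup>/\<^sup>2 x|\<^sup>2 - |R\<^sup>1\<^sup>/\<^sup>2 K x|\<^sup>2\<close>, where \<open>g = J K\<close>
  and \<open>A\<^sub>K = A + B K\<close>, is the definition of the cost. The resulting \<open>Z\<close> satisfies a strict Lyapunov inequality,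
  and \<open>X = g Z\<^sup>-\<^sup>1\<close> is feasible.\<close>

lemma stabilizing_imp_F:
  assumes stab: "K \<in> stabilizing A B"
  obtains X where "(J K, K ** X, X) \<in> F_inf A B B\<^sub>w Q R"
proof -
  obtain c where c: "gap c K" using gap_stabilizing[OF stab] .
  define g where "g = J K"
  have g: "0 < g" unfolding g_def by (rule J_pos[OF c])
  obtain N where N: "N ** B\<^sub>w = mat 1" "B\<^sub>w ** N = mat 1" by (rule Bw_inverse)
  have BN: "B\<^sub>w *v (N *v a) = a" "N *v (B\<^sub>w *v a) = a" for a by (simp_all add: matrix_vector_mul_assoc N)
  define d where "d p = N *v (snd p - closed_loop K *v fst p)" for p
  define \<beta> where "\<beta> p q = g\<^sup>2 * (d p \<bullet> d q) - (msqrt Q *v fst p) \<bullet> (msqrt Q *v fst q)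
    - (msqrt R *v (K *v fst p)) \<bullet> (msqrt R *v (K *v fst q))" for p q
  have bil: "bilinear \<beta>"
    unfolding bilinear_def
    by (intro conjI allI linearI)
      (simp_all add: \<beta>_def d_def matrix_vector_right_distrib matrix_vector_mult_scaleR matrix_vector_mult_diff_distrib
        inner_add_left inner_add_right inner_diff_left inner_diff_right algebra_simps)
  have freq: "0 \<le> \<beta> (u, - (\<omega> *\<^sub>R v)) (u, - (\<omega> *\<^sub>R v)) + \<beta> (v, \<omega> *\<^sub>R u) (v, \<omega> *\<^sub>R u)" for \<omega> u v
  proof -
    define x where "x = cvec u v"
    define w where "w = cvec (d (u, - (\<omega> *\<^sub>R v))) (d (v, \<omega> *\<^sub>R u))"
    have x: "res K \<omega> x = cmat B\<^sub>w *v w"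
      by (simp add: complex_vec_eq_iff re_im_res x_def w_def d_def BN)
    have "norm (out K *v x) \<le> g * norm w"
      using T_le_J[OF c, of \<omega> w] by (simp add: T_apply[OF c x] g_def)
    then have "(norm (out K *v x))\<^sup>2 \<le> (g * norm w)\<^sup>2" by (rule power_mono) simp
    then show ?thesis
      unfolding norm_out power_mult_distrib norm_complex_vec[of w]
      by (simp add: \<beta>_def x_def w_def distrib_left dot_square_norm)
  qed
  have "0 \<le> \<beta> (0, y) (0, y)" for y by (simp add: \<beta>_def)
  then obtain Z where Z: "transpose Z = Z" "\<And>x y. 2 * (x \<bullet> (Z *v y)) \<le> \<beta> (x, y) (x, y)"
    using kyp[OF bil freq] by metis
  have diss: "x \<bullet> (Z *v (closed_loop K *v x)) < 0" if "x \<noteq> 0" for x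
  proof -
    have "0 < (msqrt Q *v x) \<bullet> (msqrt Q *v x)" using that by (simp add: msqrt_eq_0_iff[OF posdef_Q])
    moreover have "0 \<le> (msqrt R *v (K *v x)) \<bullet> (msqrt R *v (K *v x))" by simp
    moreover have "2 * (x \<bullet> (Z *v (closed_loop K *v x))) \<le> - ((msqrt Q *v x) \<bullet> (msqrt Q *v x))
        - (msqrt R *v (K *v x)) \<bullet> (msqrt R *v (K *v x))"
      using Z(2)[of x "closed_loop K *v x"] by (simp add: \<beta>_def d_def)
    ultimately show ?thesis by linarith
  qed
  have pZ: "posdef Z"
    by (rule lyapunov_posdef[OF Z(1) diss]) (use stab in \<open>auto simp: stabilizing_iff closed_loop_def\<close>)
  obtain Z' where Z': "Z ** Z' = mat 1" "Z' ** Z = mat 1" using posdef_invertible[OF pZ] by (auto simp: invertible_def)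
  have ZZ': "Z *v (Z' *v a) = a" "Z' *v (Z *v a) = a" for a by (simp_all add: matrix_vector_mul_assoc Z')
  have sZ: "(Z *v a) \<bullet> b = a \<bullet> (Z *v b)" for a b by (rule inner_symmetric_matrix[OF Z(1)])
  define X where "X = g *\<^sub>R Z'"
  have Xv: "X *v v = g *\<^sub>R (Z' *v v)" for v by (simp add: X_def scaleR_matrix_vector)
  have ZX: "Z *v (X *v v) = g *\<^sub>R v" for v by (simp add: Xv matrix_vector_mult_scaleR ZZ')
  have sX: "(X *v a) \<bullet> b = a \<bullet> (X *v b)" for a b
    using sZ[of "Z' *v a" "Z' *v b"] by (simp add: Xv ZZ')
  have "0 < v \<bullet> (X *v v)" if "v \<noteq> 0" for v
  proof -
    have "Z' *v v \<noteq> 0" using that ZZ'(1)[of v] by auto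
    then have "0 < (Z' *v v) \<bullet> (Z *v (Z' *v v))" using pZ by (simp add: posdef_def)
    then show ?thesis using g by (simp add: Xv ZZ' inner_commute)
  qed
  then have pX: "posdef X" using symmetric_matrixI[of X] sX by (simp add: posdef_def)
  have "2 * (v \<bullet> (closed_loop K *v (X *v v))) + 2 * (v \<bullet> (B\<^sub>w *v w))
      + 2 * ((msqrt Q *v (X *v v)) \<bullet> y) + 2 * ((msqrt R *v (K *v (X *v v))) \<bullet> z)
      \<le> g * (w \<bullet> w + y \<bullet> y + z \<bullet> z)" for v w y z
  proof -
    define x where "x = X *v v"
    define s where "s = msqrt Q *v x"
    define r where "r = msqrt R *v (K *v x)"
    have "2 * (x \<bullet> (Z *v (closed_loop K *v x + B\<^sub>w *v w))) \<le> g\<^sup>2 * (w \<bullet> w) - s \<bullet> s - r \<bullet> r"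
      using Z(2)[of x "closed_loop K *v x + B\<^sub>w *v w"] by (simp add: \<beta>_def d_def BN s_def r_def)
    then have "2 * g * (v \<bullet> (closed_loop K *v x + B\<^sub>w *v w)) \<le> g\<^sup>2 * (w \<bullet> w) - s \<bullet> s - r \<bullet> r"
      by (simp add: x_def ZX flip: sZ)
    then have "2 * g * (v \<bullet> (closed_loop K *v x + B\<^sub>w *v w)) + 2 * g * (s \<bullet> y) + 2 * g * (r \<bullet> z)
        \<le> g\<^sup>2 * (w \<bullet> w) + g\<^sup>2 * (y \<bullet> y) + g\<^sup>2 * (z \<bullet> z)"
      using inner_scaled_le[of g s y] inner_scaled_le[of g r z] by linarith
    then have "g * (2 * (v \<bullet> (closed_loop K *v x + B\<^sub>w *v w)) + 2 * (s \<bullet> y) + 2 * (r \<bullet> z))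
        \<le> g * (g * (w \<bullet> w + y \<bullet> y + z \<bullet> z))"
      by (simp add: algebra_simps power2_eq_square)
    then show ?thesis using g by (simp add: x_def s_def r_def inner_add_right)
  qed
  then have "(J K, K ** X, X) \<in> F_inf A B B\<^sub>w Q R" using pX by (simp add: F_gain_iff g_def)
  then show thesis by (rule that)
qed

lemma F_gain:
  assumes "(\<gamma>, Y, X) \<in> F_inf A B B\<^sub>w Q R"
  obtains K where "Y = K ** X"
proof -
  have "posdef X" using assms by (simp add: F_iff)
  then obtain N where "N ** X = mat 1" using posdef_invertible by (auto simp: invertible_def)
  then have "Y = (Y ** N) ** X" by (simp add: matrix_mul_assoc[symmetric])
  then show thesis by (rule that)
qed

lemma inf_cost_eq:
  "(INF K\<in>stabilizing A B. ereal (J K)) = (INF (\<gamma>, Y, X)\<in>F_inf A B B\<^sub>w Q R. ereal \<gamma>)"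
proof (rule INF_eq)
  fix K assume "K \<in> stabilizing A B"
  then obtain X where "(J K, K ** X, X) \<in> F_inf A B B\<^sub>w Q R" by (rule stabilizing_imp_F)
  then show "\<exists>p\<in>F_inf A B B\<^sub>w Q R. (case p of (\<gamma>, Y, X) \<Rightarrow> ereal \<gamma>) \<le> ereal (J K)" by (rule bexI[rotated]) simp
next
  fix p assume p: "p \<in> F_inf A B B\<^sub>w Q R"
  obtain \<gamma> Y X where p': "p = (\<gamma>, Y, X)" by (metis prod.exhaust)
  obtain K where "Y = K ** X" using p unfolding p' by (rule F_gain)
  then have "K \<in> stabilizing A B" "J K \<le> \<gamma>" using F_imp_cost_le[of \<gamma> K X] p p' by simp_all
  then show "\<exists>K\<in>stabilizing A B. ereal (J K) \<le> (case p of (\<gamma>, Y, X) \<Rightarrow> ereal \<gamma>)"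
    by (intro bexI[of _ K]) (simp_all add: p')
qed

end


section \<open>Clarke stationary points\<close>

text \<open>The hypothesis \<open>wc\<close> is a form of weak convexity (the difference quotients along a line are nondecreasing up to an
  error of order \<open>s\<close>, uniformly in the base point), which makes the quotients at \<open>K\<close> itself control the Clarke
  derivative.\<close>

lemma clarke_stationary_weakly_convex:
  fixes f :: "'a::real_inner \<Rightarrow> real"
  assumes stat: "0 \<in> clarke_subdiff f K"
    and lip: "\<And>P P'. norm (P - K) \<le> r \<Longrightarrow> norm (P' - K) \<le> r \<Longrightarrow> f P' \<le> f P + L * norm (P' - P)"
    and wc: "\<And>P v s t. norm (P - K) \<le> r \<Longrightarrow> norm (P + s *\<^sub>R v - K) \<le> r \<Longrightarrow> 0 < t \<Longrightarrow> t \<le> s \<Longrightarrow>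
      (f (P + t *\<^sub>R v) - f P) / t \<le> (f (P + s *\<^sub>R v) - f P) / s + C * s * (norm v)\<^sup>2"
    and s: "0 < s" "s * norm v < r" and L: "0 \<le> L"
  shows "0 \<le> (f (K + s *\<^sub>R v) - f K) / s + C * s * (norm v)\<^sup>2"
proof (rule ccontr)
  define a where "a = (f (K + s *\<^sub>R v) - f K) / s + C * s * (norm v)\<^sup>2"
  assume "\<not> ?thesis"
  then have a: "a < 0" by (simp add: a_def)
  \<comment> \<open>On the ball of radius \<open>d\<close>, the Lipschitz bound changes the quotient with step \<open>s\<close> by at most \<open>- a / 2\<close>.\<close>
  define d where "d = min (r - s * norm v) (- a * s / (4 * (L + 1)))"
  have "0 < - a * s / (4 * (L + 1))" using s(1) L a by (intro divide_pos_pos mult_pos_pos) auto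
  then have d: "0 < d" using s(2) by (simp only: d_def min_less_iff_conj) simp
  have dr: "d + s * norm v \<le> r" and dL: "d * (4 * (L + 1)) \<le> - a * s"
  proof -
    have "d \<le> r - s * norm v" "d \<le> - a * s / (4 * (L + 1))"
      unfolding d_def by (rule min.cobounded1, rule min.cobounded2)
    moreover have "0 < 4 * (L + 1)" using L by simp
    ultimately show "d + s * norm v \<le> r" "d * (4 * (L + 1)) \<le> - a * s"
      by (simp_all only: pos_le_divide_eq)
  qed
  have quot: "(f (P + t *\<^sub>R v) - f P) / t \<le> a / 2" if P: "norm (P - K) \<le> d" and t: "0 < t" "t \<le> s" for P t
  proof -
    have sv: "0 \<le> s * norm v" using s(1) by simp
    have n1: "norm (P - K) \<le> r" using P dr sv by linarith
    have n2: "norm (P + s *\<^sub>R v - K) \<le> r"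
      using norm_triangle_ineq[of "P - K" "s *\<^sub>R v"] P dr s(1) by (simp add: algebra_simps)
    have n3: "norm (K + s *\<^sub>R v - K) \<le> r" using s by simp
    have n4: "norm (K - K) \<le> r" using d dr sv by simp
    have "f (P + s *\<^sub>R v) \<le> f (K + s *\<^sub>R v) + L * norm (P - K)" using lip[OF n3 n2] by simp
    moreover have "f K \<le> f P + L * norm (P - K)" using lip[OF n1 n4] by (simp add: norm_minus_commute)
    moreover have "L * norm (P - K) \<le> L * d" using P L by (intro mult_left_mono)
    ultimately have "f (P + s *\<^sub>R v) - f P \<le> f (K + s *\<^sub>R v) - f K + 2 * L * d" by linarith
    moreover have "2 * L * d \<le> - a * s / 2" using dL d by (simp add: algebra_simps)
    ultimately have "f (P + s *\<^sub>R v) - f P \<le> f (K + s *\<^sub>R v) - f K - a / 2 * s" by (simp add: algebra_simps)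
    then have "(f (P + s *\<^sub>R v) - f P) / s \<le> (f (K + s *\<^sub>R v) - f K) / s - a / 2"
      using divide_right_mono[of _ _ s] s(1) by (fastforce simp: diff_divide_distrib)
    moreover have "C * s * (norm v)\<^sup>2 = a - (f (K + s *\<^sub>R v) - f K) / s" by (simp add: a_def)
    ultimately show ?thesis using wc[OF n1 n2 t] by linarith
  qed
  have "eventually (\<lambda>P. norm (P - K) \<le> d) (nhds K)"
    using d eventually_nhds_metric[of _ K] by (auto simp: dist_norm intro!: exI[of _ d])
  moreover have "eventually (\<lambda>t. 0 < t \<and> t \<le> s) (at_right 0)"
    using eventually_at_right_less[of "0::real"] s(1) by (auto simp: eventually_at_right intro!: exI[of _ s])
  ultimately have "eventually (\<lambda>p. norm (fst p - K) \<le> d \<and> (0 < snd p \<and> snd p \<le> s)) (nhds K \<times>\<^sub>F at_right 0)"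
    by (rule eventually_prodI)
  then have "eventually (\<lambda>p. (case p of (P, t) \<Rightarrow> ereal ((f (P + t *\<^sub>R v) - f P) / t)) \<le> ereal (a / 2))
      (nhds K \<times>\<^sub>F at_right 0)"
  proof eventually_elim
    case (elim p)
    then show ?case using quot[of "fst p" "snd p"] by (simp only: case_prod_beta ereal_less_eq simp_thms)
  qed
  then have "Limsup (nhds K \<times>\<^sub>F at_right 0) (\<lambda>(P, t). ereal ((f (P + t *\<^sub>R v) - f P) / t)) \<le> ereal (a / 2)"
    by (rule Limsup_bounded)
  moreover have "ereal 0 \<le> Limsup (nhds K \<times>\<^sub>F at_right 0) (\<lambda>(P, t). ereal ((f (P + t *\<^sub>R v) - f P) / t))"
    using stat unfolding clarke_subdiff_def by (metis (mono_tags, lifting) inner_zero_left mem_Collect_eq)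
  ultimately have "ereal 0 \<le> ereal (a / 2)" by (rule order_trans[rotated])
  then show False using a by simp
qed

lemma matrix_mult_scaleR: "M ** (r *\<^sub>R N) = r *\<^sub>R (M ** N)" "(r *\<^sub>R N') ** M' = r *\<^sub>R (N' ** M')"
  for M :: "real^'k^'l" and N :: "real^'n^'k" and M' :: "real^'k^'l" and N' :: "real^'l^'n"
  by (simp_all add: vec_eq_iff matrix_matrix_mult_def sum_distrib_left mult_ac)

lemma matrix_mult_distribs:
  "(M + M') ** N = M ** N + M' ** N" "(M - M') ** N = M ** N - M' ** N" "M ** (N - N') = M ** N - M ** N'"
  for M M' :: "real^'k^'l" and N N' :: "real^'n^'k"
  by (simp_all add: vec_eq_iff matrix_matrix_mult_def algebra_simps sum.distrib sum_subtractf)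

lemma cmat_add: "cmat (M + N) = cmat M + cmat N" and cmat_scaleR: "cmat (r *\<^sub>R M) = r *\<^sub>R cmat M"
  by (simp_all add: vec_eq_iff complex_eq_iff)

lemma complex_scaleR_matrix_vector: "(r *\<^sub>R M) *v x = r *\<^sub>R (M *v x)" for M :: "complex^'n^'m"
  by (simp add: vec_eq_iff matrix_vector_mult_def scaleR_sum_right)

context hinf_problem
begin

text \<open>The changes of \<open>A + B K\<close> and of the output matrix caused by adding \<open>D\<close> to the gain, as maps on states.\<close>

definition B_gain :: "real^'n^'m \<Rightarrow> complex^'n \<Rightarrow> complex^'n" where
  "B_gain D x = cmat (B ** D) *v x"

definition out_gain :: "real^'n^'m \<Rightarrow> complex^'n \<Rightarrow> complex^('n + 'm)" where
  "out_gain D x = cmat ((0 :: real^'n^'n) /// msqrt R ** D) *v x"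

lemma bilinear_gains: "bilinear B_gain" "bilinear out_gain"
proof -
  have vc: "((0 :: real^'n^'n) /// M + N) = (0 /// M) + (0 /// N)" "((0 :: real^'n^'n) /// r *\<^sub>R M) = r *\<^sub>R (0 /// M)"
    for M N :: "real^'n^'m" and r
    by (auto simp: vec_eq_iff vcat_def split: sum.split)
  show "bilinear B_gain" "bilinear out_gain"
    unfolding bilinear_def
    by (auto intro!: linearI simp: B_gain_def out_gain_def vc matrix_add_ldistrib matrix_mult_scaleR cmat_add cmat_scaleR
        matrix_vector_mult_add_rdistrib matrix_vector_right_distrib complex_scaleR_matrix_vector
        complex_matrix_vector_mult_scaleR)
qed

lemma res_add: "res (K + D) \<omega> x = res K \<omega> x - B_gain D x"
  by (simp add: res_def closed_loop_def B_gain_def matrix_add_ldistrib cmat_add matrix_vector_mult_add_rdistrib)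

lemma out_add: "out (K + D) *v x = out K *v x + out_gain D x"
proof -
  have "(msqrt Q /// msqrt R ** (K + D)) = (msqrt Q /// msqrt R ** K) + (0 /// msqrt R ** D)"
    by (auto simp: vec_eq_iff vcat_def matrix_add_ldistrib split: sum.split)
  then show ?thesis by (simp add: out_def out_gain_def cmat_add matrix_vector_mult_add_rdistrib)
qed

lemma gap_perturb:
  assumes c: "gap c K" and b: "\<And>D x. norm (B_gain D x) \<le> b * norm D * norm x" "0 < b"
    and D: "norm (P - K) \<le> c / (2 * b)"
  shows "gap (c / 2) P"
proof -
  have "c / 2 * norm x \<le> norm (res P \<omega> x)" for \<omega> x
  proof -
    have "norm (B_gain (P - K) x) \<le> (b * norm (P - K)) * norm x" by (rule b(1))
    also have "\<dots> \<le> c / 2 * norm x" using D b(2) by (intro mult_right_mono) (auto simp: field_simps)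
    finally have "norm (B_gain (P - K) x) \<le> c / 2 * norm x" .
    moreover have "res P \<omega> x = res K \<omega> x - B_gain (P - K) x" using res_add[of K "P - K"] by simp
    ultimately show ?thesis
      using gapD(2)[OF c, of x \<omega>] norm_triangle_ineq2[of "res K \<omega> x" "B_gain (P - K) x"] by simp
  qed
  then show ?thesis using gapD(1)[OF c] by (simp add: gap_def)
qed

text \<open>Let \<open>h\<close> be a lower bound for \<open>i \<omega> - A - B P\<close> near \<open>K\<close>, and let \<open>x P\<close> be the response to \<open>w\<close> under the gain \<open>P\<close>.
  The first estimate comes from \<open>res P' (x P' - x P) = B (P' - P) (x P)\<close>. For the second, let
  \<open>z = x (P + t v) - (1 - \<theta>) x P - \<theta> x (P + s v)\<close> with \<open>\<theta> = t / s\<close>; then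
  \<open>res P z = t B v (x (P + t v) - x (P + s v))\<close>, which is of order \<open>s t\<close> by the first estimate.\<close>

lemma local_estimates:
  assumes stab: "K \<in> stabilizing A B"
  obtains r L C where "0 < r" "0 \<le> L" "0 \<le> C"
    "\<And>P P'. norm (P - K) \<le> r \<Longrightarrow> norm (P' - K) \<le> r \<Longrightarrow> J P' \<le> J P + L * norm (P' - P)"
    "\<And>P v s t. norm (P - K) \<le> r \<Longrightarrow> norm (P + s *\<^sub>R v - K) \<le> r \<Longrightarrow> 0 < t \<Longrightarrow> t \<le> s \<Longrightarrow>
      (J (P + t *\<^sub>R v) - J P) / t \<le> (J (P + s *\<^sub>R v) - J P) / s + C * s * (norm v)\<^sup>2"
proof -
  obtain c where c: "gap c K" using gap_stabilizing[OF stab] .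
  obtain b where b: "0 < b" "\<And>D x. norm (B_gain D x) \<le> b * norm D * norm x"
    using bilinear_bounded_pos[OF bilinear_gains(1)] by blast
  obtain e where e: "0 < e" "\<And>D x. norm (out_gain D x) \<le> e * norm D * norm x"
    using bilinear_bounded_pos[OF bilinear_gains(2)] by blast
  obtain o0 where o0: "0 < o0" "\<And>x. norm (out K *v x) \<le> o0 * norm x"
    using linear_bounded_pos[of "(*v) (out K)"] by auto
  obtain d where d: "0 < d" "\<And>w. norm (cmat B\<^sub>w *v w) \<le> d * norm w"
    using linear_bounded_pos[of "(*v) (cmat B\<^sub>w)"] by auto
  define h where "h = c / 2"
  define r where "r = c / (2 * b)"
  have h: "0 < h" and r: "0 < r" using gapD(1)[OF c] b(1) by (simp_all add: h_def r_def)
  define g where "g = o0 + e * r"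
  have g: "0 < g" using o0 e r by (simp add: g_def add_pos_pos)
  define near where "near P \<longleftrightarrow> norm (P - K) \<le> r" for P
  have gap: "gap h P" if "near P" for P
    using gap_perturb[OF c b(2) b(1)] that by (simp add: h_def r_def near_def)
  have out_le: "norm (out P *v x) \<le> g * norm x" if "near P" for P x
  proof -
    have "out P *v x = out K *v x + out_gain (P - K) x" using out_add[of K "P - K"] by simp
    moreover have "norm (out_gain (P - K) x) \<le> e * r * norm x"
      by (rule order_trans[OF e(2)]) (use that e(1) in \<open>auto simp: near_def intro!: mult_right_mono\<close>)
    ultimately show ?thesis
      using norm_triangle_ineq[of "out K *v x" "out_gain (P - K) x"] o0(2)[of x]
      by (simp add: g_def distrib_right)
  qed
  have solve: "norm x \<le> norm (res P \<omega> x) / h" if "near P" for P \<omega> x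
    using gapD(2)[OF gap[OF that], of x \<omega>] h by (simp add: field_simps)
  define M where "M = b * d / (h * h)"
  have M: "0 < M" using b d h by (simp add: M_def)
  have response: "norm (x' - x) \<le> M * norm (P' - P) * norm w"
    if near: "near P" "near P'" and x: "res P \<omega> x = cmat B\<^sub>w *v w" "res P' \<omega> x' = cmat B\<^sub>w *v w"
    for P P' \<omega> w x x'
  proof -
    have "res P' \<omega> x = res P \<omega> x - B_gain (P' - P) x" using res_add[of P "P' - P"] by simp
    then have "res P' \<omega> (x' - x) = B_gain (P' - P) x" by (simp add: linear_diff[OF linear_res] x)
    then have "norm (x' - x) \<le> norm (B_gain (P' - P) x) / h" using solve[OF near(2), of "x' - x" \<omega>] by simp
    also have "\<dots> \<le> (b * norm (P' - P) * norm x) / h" using b(2) h by (intro divide_right_mono) auto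
    also have "\<dots> \<le> (b * norm (P' - P) * (d * norm w / h)) / h"
    proof -
      have "norm x \<le> d * norm w / h"
        by (rule order_trans[OF solve[OF near(1), of x \<omega>]]) (use d(2)[of w] h in \<open>simp add: x divide_right_mono\<close>)
      then show ?thesis using b(1) h by (intro divide_right_mono mult_left_mono) auto
    qed
    finally show ?thesis by (simp add: M_def mult_ac)
  qed
  have response_le: "norm x \<le> d / h * norm w" if "near P" "res P \<omega> x = cmat B\<^sub>w *v w" for P \<omega> x w
    by (rule order_trans[OF solve[OF that(1), of x \<omega>]])
      (use d(2)[of w] h that(2) in \<open>simp add: divide_right_mono\<close>)
  define L where "L = g * M + e * (d / h)"
  have L: "0 \<le> L" using g M e d h by (simp add: L_def)
  have lip: "J P' \<le> J P + L * norm (P' - P)" if near: "near P" "near P'" for P P'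
  proof (rule J_le)
    fix \<omega> w
    obtain x where x: "res P \<omega> x = cmat B\<^sub>w *v w" using res_surj[OF gap[OF near(1)]] by blast
    obtain x' where x': "res P' \<omega> x' = cmat B\<^sub>w *v w" using res_surj[OF gap[OF near(2)]] by blast
    have eq: "out P' *v x' = out P *v x + (out P' *v (x' - x) + out_gain (P' - P) x)"
      using out_add[of P "P' - P" x] by (simp add: matrix_vector_mult_diff_distrib)
    have "norm (out P' *v (x' - x)) \<le> g * (M * norm (P' - P) * norm w)"
      by (rule order_trans[OF out_le[OF near(2)]])
        (intro mult_left_mono response[OF near x x'], use g in simp)
    moreover have "norm (out_gain (P' - P) x) \<le> e * norm (P' - P) * (d / h * norm w)"
      by (rule order_trans[OF e(2)]) (intro mult_left_mono response_le[OF near(1) x], use e(1) in simp)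
    moreover have "norm (out P *v x) \<le> J P * norm w"
      using T_le_J[OF gap[OF near(1)], of \<omega> w] by (simp add: T_apply[OF gap[OF near(1)] x])
    moreover have "norm (out P' *v x') \<le> norm (out P *v x) + (norm (out P' *v (x' - x)) + norm (out_gain (P' - P) x))"
      unfolding eq by (meson norm_triangle_ineq norm_triangle_mono order_refl order_trans)
    ultimately have "norm (out P' *v x') \<le> J P * norm w + (g * (M * norm (P' - P) * norm w) + e * norm (P' - P) * (d / h * norm w))"
      by linarith
    also have "\<dots> = (J P + L * norm (P' - P)) * norm w"
      by (simp add: L_def algebra_simps)
    finally show "norm (T P' \<omega> *v w) \<le> (J P + L * norm (P' - P)) * norm w"
      by (simp add: T_apply[OF gap[OF near(2)] x'])
  qed
  define C where "C = g * (b / h) * M + e * M"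
  have C: "0 \<le> C" using g M e b h by (simp add: C_def)
  have wc: "(J (P + t *\<^sub>R v) - J P) / t \<le> (J (P + s *\<^sub>R v) - J P) / s + C * s * (norm v)\<^sup>2"
    if near: "near P" "near (P + s *\<^sub>R v)" and t: "0 < t" "t \<le> s" for P v s t
  proof -
    define \<theta> where "\<theta> = t / s"
    have \<theta>: "0 \<le> \<theta>" "\<theta> \<le> 1" "\<theta> * s = t" using t by (auto simp: \<theta>_def)
    have near_t: "near (P + t *\<^sub>R v)"
    proof -
      have "P + t *\<^sub>R v - K = (1 - \<theta>) *\<^sub>R (P - K) + \<theta> *\<^sub>R (P + s *\<^sub>R v - K)"
        by (simp add: algebra_simps \<theta>(3))
      also have "norm \<dots> \<le> (1 - \<theta>) * norm (P - K) + \<theta> * norm (P + s *\<^sub>R v - K)"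
        by (rule order_trans[OF norm_triangle_ineq]) (use \<theta> in simp)
      also have "\<dots> \<le> (1 - \<theta>) * r + \<theta> * r"
        using \<theta> near by (intro add_mono mult_left_mono) (auto simp: near_def)
      finally show ?thesis by (simp add: near_def algebra_simps)
    qed
    define E where "E = C * (t * s) * (norm v)\<^sup>2"
    have "J (P + t *\<^sub>R v) \<le> (1 - \<theta>) * J P + \<theta> * J (P + s *\<^sub>R v) + E"
    proof (rule J_le)
      fix \<omega> w
      obtain x0 where x0: "res P \<omega> x0 = cmat B\<^sub>w *v w" using res_surj[OF gap[OF near(1)]] by blast
      obtain xs where xs: "res (P + s *\<^sub>R v) \<omega> xs = cmat B\<^sub>w *v w" using res_surj[OF gap[OF near(2)]] by blast
      obtain xt where xt: "res (P + t *\<^sub>R v) \<omega> xt = cmat B\<^sub>w *v w" using res_surj[OF gap[OF near_t]] by blast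
      have diff: "norm (xt - xs) \<le> M * (s * norm v) * norm w"
      proof -
        have "norm ((P + t *\<^sub>R v) - (P + s *\<^sub>R v)) = (s - t) * norm v"
          using t by (simp add: scaleR_diff_left[symmetric] abs_if)
        also have "\<dots> \<le> s * norm v" using t by (intro mult_right_mono) auto
        finally have "M * norm ((P + t *\<^sub>R v) - (P + s *\<^sub>R v)) * norm w \<le> M * (s * norm v) * norm w"
          using M by (intro mult_right_mono mult_left_mono) auto
        then show ?thesis using response[OF near(2) near_t xs xt] by linarith
      qed
      define z where "z = xt - (1 - \<theta>) *\<^sub>R x0 - \<theta> *\<^sub>R xs"
      have gain: "B_gain (a *\<^sub>R v) y = a *\<^sub>R B_gain v y" "out_gain (a *\<^sub>R v) y = a *\<^sub>R out_gain v y"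
        "B_gain v (y - y') = B_gain v y - B_gain v y'" "out_gain v (y - y') = out_gain v y - out_gain v y'" for a y y'
        by (simp_all add: bilinear_lmul[OF bilinear_gains(1)] bilinear_lmul[OF bilinear_gains(2)]
            bilinear_rsub[OF bilinear_gains(1)] bilinear_rsub[OF bilinear_gains(2)])
      have rs: "res P \<omega> xs = cmat B\<^sub>w *v w + s *\<^sub>R B_gain v xs" "res P \<omega> xt = cmat B\<^sub>w *v w + t *\<^sub>R B_gain v xt"
        using xs xt by (simp_all add: res_add gain algebra_simps)
      have "res P \<omega> z = res P \<omega> xt - (1 - \<theta>) *\<^sub>R res P \<omega> x0 - \<theta> *\<^sub>R res P \<omega> xs"
        by (simp only: z_def linear_diff[OF linear_res] linear_cmul[OF linear_res])
      also have "\<dots> = t *\<^sub>R B_gain v xt - (\<theta> * s) *\<^sub>R B_gain v xs"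
        by (simp add: x0 rs algebra_simps)
      finally have "res P \<omega> z = t *\<^sub>R B_gain v (xt - xs)"
        by (simp add: \<theta>(3) gain scaleR_diff_right)
      then have "norm z \<le> t * (b * norm v * norm (xt - xs)) / h"
        using solve[OF near(1), of z \<omega>] b(2)[of v "xt - xs"] t h
        by (smt (verit, best) abs_of_pos divide_right_mono mult_left_mono norm_scaleR)
      also have "\<dots> \<le> t * (b * norm v * (M * (s * norm v) * norm w)) / h"
        using diff t b(1) h by (intro divide_right_mono mult_left_mono) auto
      finally have z: "norm z \<le> t * (b * norm v * (M * (s * norm v) * norm w)) / h" .
      have eq: "out (P + t *\<^sub>R v) *v xt = (1 - \<theta>) *\<^sub>R (out P *v x0) + \<theta> *\<^sub>R (out (P + s *\<^sub>R v) *v xs)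
          + (out P *v z + t *\<^sub>R out_gain v (xt - xs))"
      proof -
        have "out P *v z = out P *v xt - (1 - \<theta>) *\<^sub>R (out P *v x0) - \<theta> *\<^sub>R (out P *v xs)"
          by (simp only: z_def matrix_vector_mult_diff_distrib complex_matrix_vector_mult_scaleR)
        then show ?thesis
          by (simp add: out_add gain scaleR_add_right scaleR_diff_right \<theta>(3))
      qed
      have n1: "norm ((1 - \<theta>) *\<^sub>R (out P *v x0)) \<le> (1 - \<theta>) * (J P * norm w)"
        using T_le_J[OF gap[OF near(1)], of \<omega> w] \<theta> by (simp add: T_apply[OF gap[OF near(1)] x0] mult_left_mono)
      have n2: "norm (\<theta> *\<^sub>R (out (P + s *\<^sub>R v) *v xs)) \<le> \<theta> * (J (P + s *\<^sub>R v) * norm w)"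
        using T_le_J[OF gap[OF near(2)], of \<omega> w] \<theta> by (simp add: T_apply[OF gap[OF near(2)] xs] mult_left_mono)
      have n3: "norm (out P *v z) \<le> g * (t * (b * norm v * (M * (s * norm v) * norm w)) / h)"
        by (rule order_trans[OF out_le[OF near(1)]]) (intro mult_left_mono z, use g in simp)
      have n4: "norm (t *\<^sub>R out_gain v (xt - xs)) \<le> t * (e * norm v * (M * (s * norm v) * norm w))"
      proof -
        have "norm (out_gain v (xt - xs)) \<le> e * norm v * (M * (s * norm v) * norm w)"
          by (rule order_trans[OF e(2)]) (intro mult_left_mono diff, use e(1) in simp)
        then show ?thesis using t by (simp add: mult_left_mono)
      qed
      have "norm (out (P + t *\<^sub>R v) *v xt) \<le> (1 - \<theta>) * (J P * norm w) + \<theta> * (J (P + s *\<^sub>R v) * norm w)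
          + (g * (t * (b * norm v * (M * (s * norm v) * norm w)) / h) + t * (e * norm v * (M * (s * norm v) * norm w)))"
        unfolding eq by (intro norm_triangle_mono n1 n2 n3 n4)
      also have "\<dots> = ((1 - \<theta>) * J P + \<theta> * J (P + s *\<^sub>R v) + E) * norm w"
        by (simp add: E_def C_def power2_eq_square algebra_simps)
      finally show "norm (T (P + t *\<^sub>R v) \<omega> *v w) \<le> ((1 - \<theta>) * J P + \<theta> * J (P + s *\<^sub>R v) + E) * norm w"
        by (simp add: T_apply[OF gap[OF near_t] xt])
    qed
    then have "J (P + t *\<^sub>R v) - J P \<le> \<theta> * (J (P + s *\<^sub>R v) - J P) + E" by (simp add: algebra_simps)
    then have "(J (P + t *\<^sub>R v) - J P) / t \<le> (\<theta> * (J (P + s *\<^sub>R v) - J P) + E) / t"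
      using t by (intro divide_right_mono) auto
    also have "\<dots> = (J (P + s *\<^sub>R v) - J P) / s + C * s * (norm v)\<^sup>2"
      using t by (simp add: \<theta>_def E_def field_simps)
    finally show ?thesis .
  qed
  show thesis
    by (rule that[OF r L C]) (use lip wc in \<open>auto simp: near_def\<close>)
qed

text \<open>If \<open>J K' < J K\<close>, then the segment in the convex set from a point over \<open>K\<close> to a point over \<open>K'\<close> projects to a
  curve of gains with initial velocity \<open>v = (K' - K) X' X\<^sup>-\<^sup>1\<close>, along which \<open>J\<close> decreases at least linearly. The
  deviation \<open>E\<close> of this curve from the line \<open>K + s v\<close> is of order \<open>s\<^sup>2\<close>.\<close>

lemma stationary_imp_optimal:
  assumes K: "K \<in> stabilizing A B" and stat: "0 \<in> clarke_subdiff (J_inf A B B\<^sub>w Q R) K"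
    and K': "K' \<in> stabilizing A B"
  shows "J K \<le> J K'"
proof (rule ccontr)
  define c where "c = J K - J K'"
  assume "\<not> ?thesis"
  then have c: "0 < c" by (simp add: c_def)
  obtain r L C where r: "0 < r" and L: "0 \<le> L" and C: "0 \<le> C"
    and lip: "\<And>P P'. norm (P - K) \<le> r \<Longrightarrow> norm (P' - K) \<le> r \<Longrightarrow> J P' \<le> J P + L * norm (P' - P)"
    and wc: "\<And>P v s t. norm (P - K) \<le> r \<Longrightarrow> norm (P + s *\<^sub>R v - K) \<le> r \<Longrightarrow> 0 < t \<Longrightarrow> t \<le> s \<Longrightarrow>
      (J (P + t *\<^sub>R v) - J P) / t \<le> (J (P + s *\<^sub>R v) - J P) / s + C * s * (norm v)\<^sup>2"
    using local_estimates[OF K] by blast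
  obtain X where X: "(J K, K ** X, X) \<in> F_inf A B B\<^sub>w Q R" using stabilizing_imp_F[OF K] .
  obtain X' where X': "(J K', K' ** X', X') \<in> F_inf A B B\<^sub>w Q R" using stabilizing_imp_F[OF K'] .
  have "posdef X" using X by (simp add: F_iff)
  then obtain N where N: "X ** N = mat 1" "N ** X = mat 1" using posdef_invertible by (auto simp: invertible_def)
  define v where "v = (K' - K) ** X' ** N"
  define W where "W = (X - X') ** N"
  have "linear (\<lambda>E :: real^'n^'m. E ** W)"
    by (rule linearI) (simp_all add: matrix_mult_distribs matrix_mult_scaleR)
  from linear_bounded_pos[OF this] obtain k where k: "0 < k" "\<And>E :: real^'n^'m. norm (E ** W) \<le> k * norm E" by blast
  define m where "m = 2 * L * k * norm v + C * (norm v)\<^sup>2"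
  have m: "0 \<le> m" using L k C by (simp add: m_def)
  \<comment> \<open>A step that keeps both the curve and the line in the ball of radius \<open>r\<close> and makes all errors of order \<open>s\<^sup>2\<close>, which are
    collected in \<open>m s\<^sup>2\<close>, smaller than the decrease \<open>s c\<close>.\<close>
  define s where "s = min (min 1 (1 / (2 * k))) (min (r / (2 * (norm v + 1))) (c / (2 * (m + 1))))"
  have s0: "0 < s" using k r c m by (simp add: s_def add_nonneg_pos)
  have "s \<le> 1 / (2 * k)" "s \<le> r / (2 * (norm v + 1))" "s \<le> c / (2 * (m + 1))" and s1: "s \<le> 1"
    by (auto simp: s_def)
  moreover have "0 < 2 * k" "0 < 2 * (norm v + 1)" "0 < 2 * (m + 1)" using k m by (auto intro: add_nonneg_pos)
  ultimately have "s * (2 * k) \<le> 1" "s * (2 * (norm v + 1)) \<le> r" "s * (2 * (m + 1)) \<le> c"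
    by (simp_all only: pos_le_divide_eq)
  then have sk: "s * k \<le> 1 / 2" and sr: "2 * s * (norm v + 1) \<le> r" and sm: "2 * s * (m + 1) \<le> c"
    by (simp_all add: mult_ac)
  define Xs where "Xs = (1 - s) *\<^sub>R X + s *\<^sub>R X'"
  have "(1 - s) *\<^sub>R (J K, K ** X, X) + s *\<^sub>R (J K', K' ** X', X') \<in> F_inf A B B\<^sub>w Q R"
    using convexD[OF convex_F X X', of "1 - s" s] s0 s1 by simp
  then have F: "((1 - s) * J K + s * J K', (1 - s) *\<^sub>R (K ** X) + s *\<^sub>R (K' ** X'), Xs) \<in> F_inf A B B\<^sub>w Q R"
    by (simp add: Xs_def)
  obtain Ks where Ks: "(1 - s) *\<^sub>R (K ** X) + s *\<^sub>R (K' ** X') = Ks ** Xs" by (rule F_gain[OF F])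
  have JKs: "J Ks \<le> J K - s * c"
    using F_imp_cost_le(2)[OF F[unfolded Ks]] by (simp add: c_def algebra_simps)
  define E where "E = Ks - K - s *\<^sub>R v"
  note mat_alg = matrix_mult_distribs matrix_add_ldistrib matrix_mult_scaleR
  have E: "E = s\<^sup>2 *\<^sub>R (v ** W) + s *\<^sub>R (E ** W)"
  proof -
    have vX: "v ** X = (K' - K) ** X'" by (simp add: v_def N flip: matrix_mul_assoc)
    have "E ** Xs = s\<^sup>2 *\<^sub>R (v ** (X - X'))"
    proof -
      have "E ** Xs = Ks ** Xs - K ** Xs - s *\<^sub>R (v ** Xs)"
        by (simp add: E_def mat_alg)
      also have "\<dots> = s *\<^sub>R ((K' - K) ** X') - s *\<^sub>R (v ** Xs)"
        unfolding Ks[symmetric] by (simp add: Xs_def mat_alg algebra_simps)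
      also have "\<dots> = s\<^sup>2 *\<^sub>R (v ** (X - X'))"
        unfolding vX[symmetric] by (simp add: Xs_def mat_alg algebra_simps power2_eq_square)
      finally show ?thesis .
    qed
    moreover have "E ** Xs = E ** X - s *\<^sub>R (E ** (X - X'))"
      by (simp add: Xs_def mat_alg algebra_simps)
    ultimately have "E ** X - s *\<^sub>R (E ** (X - X')) = s\<^sup>2 *\<^sub>R (v ** (X - X'))" by simp
    then have "E ** X = s\<^sup>2 *\<^sub>R (v ** (X - X')) + s *\<^sub>R (E ** (X - X'))" by (simp only: diff_eq_eq)
    then have "(E ** X) ** N = s\<^sup>2 *\<^sub>R (v ** W) + s *\<^sub>R (E ** W)"
      by (simp only: matrix_mult_distribs(1) matrix_mult_scaleR W_def matrix_mul_assoc)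
    then show ?thesis by (simp add: N flip: matrix_mul_assoc)
  qed
  have nE: "norm E \<le> 2 * s\<^sup>2 * k * norm v"
  proof -
    have "norm E \<le> s\<^sup>2 * (k * norm v) + s * (k * norm E)"
      by (subst E, rule norm_triangle_mono) (use s0 k in \<open>auto intro: mult_left_mono\<close>)
    moreover have "s * (k * norm E) \<le> 1 / 2 * norm E"
      unfolding mult.assoc[symmetric] using sk by (intro mult_right_mono) auto
    ultimately show ?thesis by simp
  qed
  have sr': "2 * (s * norm v) + 2 * s \<le> r" using sr by (simp add: algebra_simps)
  moreover have "0 \<le> s * norm v" using s0 by simp
  ultimately have sv: "s * norm v < r" using s0 by linarith
  then have near1: "norm (K + s *\<^sub>R v - K) \<le> r" using s0 by simp
  have near2: "norm (Ks - K) \<le> r"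
  proof -
    have "norm (Ks - K) \<le> norm E + s * norm v"
      using norm_triangle_ineq[of E "s *\<^sub>R v"] s0 by (simp add: E_def)
    moreover have "(s * k) * (s * norm v) \<le> 1 / 2 * (s * norm v)"
      using sk s0 by (intro mult_right_mono) auto
    then have "s\<^sup>2 * k * norm v \<le> 1 / 2 * (s * norm v)" by (simp add: power2_eq_square mult_ac)
    ultimately have "norm (Ks - K) \<le> 2 * (s * norm v)" using nE by linarith
    then show ?thesis using sr' s0 by linarith
  qed
  have "J (K + s *\<^sub>R v) \<le> J Ks + L * norm E"
    using lip[OF near2 near1] by (simp add: E_def norm_minus_commute algebra_simps)
  also have "\<dots> \<le> J K - s * c + L * (2 * s\<^sup>2 * k * norm v)"
    using JKs nE L by (intro add_mono mult_left_mono)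
  finally have "(J (K + s *\<^sub>R v) - J K) / s \<le> - c + 2 * L * k * norm v * s"
    using s0 by (simp add: field_simps power2_eq_square)
  moreover have "0 \<le> (J (K + s *\<^sub>R v) - J K) / s + C * s * (norm v)\<^sup>2"
    by (rule clarke_stationary_weakly_convex[OF stat lip wc s0 sv L])
  ultimately have "c \<le> m * s" by (simp add: m_def algebra_simps)
  then show False using sm s0 c by (simp add: algebra_simps)
qed

end

theorem corollary4p1:
  fixes A B\<^sub>w Q :: "real^'n^'n" and B :: "real^'m^'n" and R :: "real^'m^'m"
  assumes "controllable A B"
    and "observable (msqrt Q) A"
    and "rank B\<^sub>w = CARD('n)"
    and "posdef Q" and "posdef R"
  shows "convex (F_inf A B B\<^sub>w Q R)
    \<and> (INF K\<in>stabilizing A B. ereal (J_inf A B B\<^sub>w Q R K))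
        = (INF (\<gamma>, Y, X)\<in>F_inf A B B\<^sub>w Q R. ereal \<gamma>)
    \<and> (\<forall>K\<in>stabilizing A B. 0 \<in> clarke_subdiff (J_inf A B B\<^sub>w Q R) K \<longrightarrow>
          (\<forall>K'\<in>stabilizing A B. J_inf A B B\<^sub>w Q R K \<le> J_inf A B B\<^sub>w Q R K'))"
proof -
  interpret hinf_problem A B\<^sub>w Q B R
    by unfold_locales (use assms in auto)
  show ?thesis
    using convex_F inf_cost_eq stationary_imp_optimal by blast
qed

end
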